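(* Let $q\in[1,+\infty)$ and let $(\Gamma,\mu)$ be a weighted graph as in the context. Assume that the doubling property $(D)$, the $L^q$ Poincaré inequality $(P_q)$ and the condition $\Delta(\alpha)$ for some $\alpha>0$ hold. Then, for all $q<p<+\infty$, $$\dot W^{1,p}(\Gamma)=\left(\dot W^{1,q}(\Gamma),\dot W^{1,\infty}(\Gamma)\right)_{1-\frac qp,\,p}$$ (with equivalent norms).
   Context: Setting. $\Gamma$ is an infinite set and $\mu_{xy}=\mu_{yx}\ge 0$ is a symmetric weight on $\Gamma\times\Gamma$. Write $x\sim y$ iff $\mu_{xy}>0$. A path of length $M$ joining $x$ to $y$ is a sequence $x_0=x,\dots,x_M=y$ with $x_i\sim x_{i+1}$ for all $0\le i\le M-1$. $\Gamma$ is assumed connected (any two points are joined by a path), and $d(x,y)$ is the shortest length of a path joining $x$ to $y$. For $r\ge0$, $B(x,r)=\{y\in\Gamma:\ d(x,y)\le r\}$. $\Gamma$ is assumed locally uniformly finite: there is an integer $N_0\ge1$ with $\sharp B(x,1)\le N_0$ for all $x\in\Gamma$. Set $m(x)=\sum_{y\sim x}\mu_{xy}$, assumed $>0$ for all $x$; $m(A)=\sum_{x\in A}m(x)$; $V(x,r)=m(B(x,r))$; $V(B)=m(B)$. For $1\le p<\infty$, $\|f\|_p=(\sum_{x\in\Gamma}|f(x)|^pm(x))^{1/p}$, $\|f\|_\infty=\sup_\Gamma|f|$, and $L^p(\Gamma)$ is the corresponding space. Let $p(x,y)=\mu_{xy}/m(x)$ and $\nabla f(x)=\left(\frac12\sum_{y}p(x,y)|f(y)-f(x)|^2\right)^{1/2}$.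 For $1\le p\le\infty$, $\dot E^{1,p}(\Gamma)$ is the space of scalar functions $f$ on $\Gamma$ with $\nabla f\in L^p(\Gamma)$, with semi-norm $\|\nabla f\|_p$, and $\dot W^{1,p}(\Gamma)=\dot E^{1,p}(\Gamma)/\mathbb R$ is its quotient by the constants, with the corresponding norm. These are Banach spaces, all contained in the space of functions on $\Gamma$ modulo constants. $(A_0,A_1)_{\theta,p}$ denotes real interpolation by the $K$-method: $K(f,t,A_0,A_1)=\inf\{\|a_0\|_{A_0}+t\|a_1\|_{A_1}:\ f=a_0+a_1\}$ and $\|f\|_{\theta,p}=\left(\int_0^\infty(t^{-\theta}K(f,t,A_0,A_1))^p\frac{dt}t\right)^{1/p}$. Conditions. $(D)$: there is $C>0$ with $V(x,2r)\le CV(x,r)$ for all $x\in\Gamma$, $r>0$. $\Delta(\alpha)$: for all $x,y\in\Gamma$, ($x\sim y\Leftrightarrow \mu_{xy}\ge\alpha m(x)$), and $x\sim x$ for all $x$. $(P_q)$: there is $C>0$ such that for all $x\in\Gamma$, $r>0$ and all functions $f$ on $\Gamma$, with $B=B(x,r)$ and $f_B=\frac1{V(B)}\sum_{z\in B}f(z)m(z)$, one has $\sum_{y\in B}|f(y)-f_B|^qm(y)\le Cr^q\sum_{y\in B}|\nabla f(y)|^qm(y)$. *)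

theory Defs
  imports "HOL-Analysis.Analysis"
begin

section \<open>Weighted graphs\<close>

text \<open>
  The vertex set is the whole type \<open>'a\<close>; its infinitude is an assumption of the locale
  \<open>weighted_graph\<close> below.
\<close>

definition adj :: "('a \<Rightarrow> 'a \<Rightarrow> real) \<Rightarrow> 'a \<Rightarrow> 'a \<Rightarrow> bool" where
  "adj \<mu> x y \<longleftrightarrow> \<mu> x y > 0"

definition joined_by_path :: "('a \<Rightarrow> 'a \<Rightarrow> real) \<Rightarrow> nat \<Rightarrow> 'a \<Rightarrow> 'a \<Rightarrow> bool" where
  "joined_by_path \<mu> M x y \<longleftrightarrow>
     (\<exists>s :: nat \<Rightarrow> 'a. s 0 = x \<and> s M = y \<and> (\<forall>i<M. adj \<mu> (s i) (s (Suc i))))"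

definition graph_dist :: "('a \<Rightarrow> 'a \<Rightarrow> real) \<Rightarrow> 'a \<Rightarrow> 'a \<Rightarrow> nat" where
  "graph_dist \<mu> x y = (LEAST M. joined_by_path \<mu> M x y)"

definition graph_ball :: "('a \<Rightarrow> 'a \<Rightarrow> real) \<Rightarrow> 'a \<Rightarrow> real \<Rightarrow> 'a set" where
  "graph_ball \<mu> x r = {y. real (graph_dist \<mu> x y) \<le> r}"

definition vertex_weight :: "('a \<Rightarrow> 'a \<Rightarrow> real) \<Rightarrow> 'a \<Rightarrow> real" where
  "vertex_weight \<mu> x = (\<Sum>y | adj \<mu> x y. \<mu> x y)"

definition volume :: "('a \<Rightarrow> 'a \<Rightarrow> real) \<Rightarrow> 'a set \<Rightarrow> real" where
  "volume \<mu> A = (\<Sum>x\<in>A. vertex_weight \<mu> x)"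

text \<open>
  In \<open>locally_uniformly_finite\<close>, finiteness of the balls is stated separately because
  \<open>card\<close> of an infinite set is 0.  It makes every sum over neighbours or over a
  ball in this theory a sum over a finite set.
\<close>

locale weighted_graph =
  fixes \<mu> :: "'a \<Rightarrow> 'a \<Rightarrow> real"
  assumes infinite_vertices: "infinite (UNIV :: 'a set)"
    and weight_nonneg: "\<mu> x y \<ge> 0"
    and weight_sym: "\<mu> x y = \<mu> y x"
    and connected: "\<exists>M. joined_by_path \<mu> M x y"
    and locally_uniformly_finite:
      "\<exists>N\<^sub>0\<ge>1. \<forall>x. finite (graph_ball \<mu> x 1) \<and> card (graph_ball \<mu> x 1) \<le> N\<^sub>0"
    and vertex_weight_pos: "vertex_weight \<mu> x > 0"

definition transition :: "('a \<Rightarrow> 'a \<Rightarrow> real) \<Rightarrow> 'a \<Rightarrow> 'a \<Rightarrow> real" where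
  "transition \<mu> x y = \<mu> x y / vertex_weight \<mu> x"

text \<open>
  The type \<open>'k\<close> of scalars ranges over the complete real normed fields, which are the real
  and the complex numbers.  The sum defining the gradient is restricted to the neighbours of
  \<open>x\<close>, since its other terms vanish.
\<close>

definition grad ::
  "('a \<Rightarrow> 'a \<Rightarrow> real) \<Rightarrow> ('a \<Rightarrow> 'k::{real_normed_field,banach}) \<Rightarrow> 'a \<Rightarrow> real" where
  "grad \<mu> f x = sqrt (1/2 * (\<Sum>y | adj \<mu> x y. transition \<mu> x y * (norm (f y - f x))\<^sup>2))"

section \<open>Conditions on the graph\<close>

definition doubling :: "('a \<Rightarrow> 'a \<Rightarrow> real) \<Rightarrow> bool" where
  "doubling \<mu> \<longleftrightarrow> (\<exists>C>0. \<forall>x. \<forall>r>0.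
     volume \<mu> (graph_ball \<mu> x (2 * r)) \<le> C * volume \<mu> (graph_ball \<mu> x r))"

definition delta_condition :: "('a \<Rightarrow> 'a \<Rightarrow> real) \<Rightarrow> real \<Rightarrow> bool" where
  "delta_condition \<mu> \<alpha> \<longleftrightarrow>
     (\<forall>x y. adj \<mu> x y \<longleftrightarrow> \<mu> x y \<ge> \<alpha> * vertex_weight \<mu> x) \<and> (\<forall>x. adj \<mu> x x)"

definition average ::
  "('a \<Rightarrow> 'a \<Rightarrow> real) \<Rightarrow> 'a set \<Rightarrow> ('a \<Rightarrow> 'k::{real_normed_field,banach}) \<Rightarrow> 'k" where
  "average \<mu> B f = (1 / volume \<mu> B) *\<^sub>R (\<Sum>z\<in>B. vertex_weight \<mu> z *\<^sub>R f z)"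

text \<open>The type argument is the scalar field in which the test functions take their values.\<close>

definition poincare ::
  "'k::{real_normed_field,banach} itself \<Rightarrow> ('a \<Rightarrow> 'a \<Rightarrow> real) \<Rightarrow> real \<Rightarrow> bool" where
  "poincare _ \<mu> q \<longleftrightarrow> (\<exists>C>0. \<forall>x. \<forall>r>0. \<forall>f :: 'a \<Rightarrow> 'k.
     (let B = graph_ball \<mu> x r in
       (\<Sum>y\<in>B. norm (f y - average \<mu> B f) powr q * vertex_weight \<mu> y)
         \<le> C * r powr q * (\<Sum>y\<in>B. grad \<mu> f y powr q * vertex_weight \<mu> y)))"

section \<open>Lebesgue spaces\<close>

definition Lp_space :: "('a \<Rightarrow> 'a \<Rightarrow> real) \<Rightarrow> ereal \<Rightarrow> ('a \<Rightarrow> real) set" where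
  "Lp_space \<mu> p = {g.
     if p = \<infinity> then bounded (range g)
     else (\<lambda>x. \<bar>g x\<bar> powr real_of_ereal p * vertex_weight \<mu> x) summable_on UNIV}"

definition Lp_norm :: "('a \<Rightarrow> 'a \<Rightarrow> real) \<Rightarrow> ereal \<Rightarrow> ('a \<Rightarrow> real) \<Rightarrow> real" where
  "Lp_norm \<mu> p g =
     (if p = \<infinity> then (SUP x. \<bar>g x\<bar>)
      else (\<Sum>\<^sub>\<infinity>x. \<bar>g x\<bar> powr real_of_ereal p * vertex_weight \<mu> x) powr (1 / real_of_ereal p))"

section \<open>Functions modulo constants\<close>

definition eq_mod_const :: "('a \<Rightarrow> 'k::{real_normed_field,banach}) \<Rightarrow> ('a \<Rightarrow> 'k) \<Rightarrow> bool" where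
  "eq_mod_const f g \<longleftrightarrow> (\<exists>c. \<forall>x. f x = g x + c)"

lemma equivp_eq_mod_const: "equivp eq_mod_const"
proof (rule equivpI)
  show "reflp eq_mod_const"
    unfolding reflp_def eq_mod_const_def by (metis add.right_neutral)
  show "symp eq_mod_const"
    unfolding symp_def eq_mod_const_def by (metis add_diff_cancel_right' diff_conv_add_uminus)
  show "transp eq_mod_const"
    unfolding transp_def eq_mod_const_def by (metis add.assoc)
qed

quotient_type (overloaded) ('a, 'k) fun_mod_const =
    "'a \<Rightarrow> 'k::{real_normed_field,banach}" / eq_mod_const
  morphisms rep_mod_const mod_const
  by (rule equivp_eq_mod_const)

instantiation fun_mod_const :: (type, "{real_normed_field,banach}") real_vector
begin

lift_definition zero_fun_mod_const :: "('a, 'b) fun_mod_const" is "\<lambda>_. 0" .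

lift_definition plus_fun_mod_const ::
  "('a, 'b) fun_mod_const \<Rightarrow> ('a, 'b) fun_mod_const \<Rightarrow> ('a, 'b) fun_mod_const"
  is "\<lambda>f g x. f x + g x"
proof -
  fix f f' g g' :: "'a \<Rightarrow> 'b"
  assume "eq_mod_const f f'" "eq_mod_const g g'"
  then obtain c d where "\<forall>x. f x = f' x + c" "\<forall>x. g x = g' x + d"
    unfolding eq_mod_const_def by blast
  then show "eq_mod_const (\<lambda>x. f x + g x) (\<lambda>x. f' x + g' x)"
    unfolding eq_mod_const_def by (intro exI[of _ "c + d"]) simp
qed

lift_definition uminus_fun_mod_const :: "('a, 'b) fun_mod_const \<Rightarrow> ('a, 'b) fun_mod_const"
  is "\<lambda>f x. - f x"
proof -
  fix f f' :: "'a \<Rightarrow> 'b"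
  assume "eq_mod_const f f'"
  then obtain c where "\<forall>x. f x = f' x + c"
    unfolding eq_mod_const_def by blast
  then show "eq_mod_const (\<lambda>x. - f x) (\<lambda>x. - f' x)"
    unfolding eq_mod_const_def by (intro exI[of _ "- c"]) simp
qed

definition minus_fun_mod_const ::
  "('a, 'b) fun_mod_const \<Rightarrow> ('a, 'b) fun_mod_const \<Rightarrow> ('a, 'b) fun_mod_const" where
  "minus_fun_mod_const F G = F + (- G)"

lift_definition scaleR_fun_mod_const ::
  "real \<Rightarrow> ('a, 'b) fun_mod_const \<Rightarrow> ('a, 'b) fun_mod_const" is "\<lambda>a f x. a *\<^sub>R f x"
proof -
  fix a :: real and f f' :: "'a \<Rightarrow> 'b"
  assume "eq_mod_const f f'"
  then obtain c where "\<forall>x. f x = f' x + c"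
    unfolding eq_mod_const_def by blast
  then show "eq_mod_const (\<lambda>x. a *\<^sub>R f x) (\<lambda>x. a *\<^sub>R f' x)"
    unfolding eq_mod_const_def by (intro exI[of _ "a *\<^sub>R c"]) (simp add: scaleR_add_right)
qed

instance
proof
  fix F G H :: "('a, 'b) fun_mod_const" and a b :: real
  have eqI: "eq_mod_const f g" if "\<And>x. f x = g x" for f g :: "'a \<Rightarrow> 'b"
    unfolding eq_mod_const_def using that by (intro exI[of _ 0]) simp
  show "F + G + H = F + (G + H)" by transfer (rule eqI, simp)
  show "F + G = G + F" by transfer (rule eqI, simp)
  show "0 + F = F" by transfer (rule eqI, simp)
  show "- F + F = 0" by transfer (rule eqI, simp)
  show "F - G = F + - G" by (rule minus_fun_mod_const_def)
  show "a *\<^sub>R (F + G) = a *\<^sub>R F + a *\<^sub>R G" by transfer (rule eqI, simp add: scaleR_add_right)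
  show "(a + b) *\<^sub>R F = a *\<^sub>R F + b *\<^sub>R F" by transfer (rule eqI, simp add: scaleR_add_left)
  show "a *\<^sub>R b *\<^sub>R F = (a * b) *\<^sub>R F" by transfer (rule eqI, simp)
  show "1 *\<^sub>R F = F" by transfer (rule eqI, simp)
qed

end

lift_definition grad_mod_const ::
  "('a \<Rightarrow> 'a \<Rightarrow> real) \<Rightarrow> ('a, 'k::{real_normed_field,banach}) fun_mod_const \<Rightarrow> 'a \<Rightarrow> real"
  is grad
proof -
  fix \<mu> :: "'a \<Rightarrow> 'a \<Rightarrow> real" and f g :: "'a \<Rightarrow> 'k"
  assume "eq_mod_const f g"
  then obtain c where "\<forall>x. f x = g x + c"
    unfolding eq_mod_const_def by blast
  then show "grad \<mu> f = grad \<mu> g"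
    unfolding grad_def by (intro ext) simp
qed

section \<open>Normed subspaces and real interpolation\<close>

text \<open>
  A normed space contained in an ambient vector space \<open>'v\<close>.  The values of \<open>norm_on\<close> outside
  \<open>elems\<close> are irrelevant.
\<close>

record 'v normed_subspace =
  elems :: "'v set"
  norm_on :: "'v \<Rightarrow> real"

definition same_space_equiv_norms ::
  "'v::real_vector normed_subspace \<Rightarrow> 'v normed_subspace \<Rightarrow> bool" where
  "same_space_equiv_norms A B \<longleftrightarrow> elems A = elems B \<and>
     (\<exists>c>0. \<exists>C>0. \<forall>f\<in>elems A. c * norm_on A f \<le> norm_on B f \<and> norm_on B f \<le> C * norm_on A f)"

definition K_functional ::
  "'v::real_vector normed_subspace \<Rightarrow> 'v normed_subspace \<Rightarrow> real \<Rightarrow> 'v \<Rightarrow> real" where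
  "K_functional A\<^sub>0 A\<^sub>1 t f =
     Inf {norm_on A\<^sub>0 a\<^sub>0 + t * norm_on A\<^sub>1 a\<^sub>1 | a\<^sub>0 a\<^sub>1.
            a\<^sub>0 \<in> elems A\<^sub>0 \<and> a\<^sub>1 \<in> elems A\<^sub>1 \<and> f = a\<^sub>0 + a\<^sub>1}"

definition K_integral ::
  "'v::real_vector normed_subspace \<Rightarrow> 'v normed_subspace \<Rightarrow> real \<Rightarrow> real \<Rightarrow> 'v \<Rightarrow> ennreal" where
  "K_integral A\<^sub>0 A\<^sub>1 \<theta> p f =
     (\<integral>\<^sup>+t\<in>{0<..}. ennreal ((t powr (- \<theta>) * K_functional A\<^sub>0 A\<^sub>1 t f) powr p / t) \<partial>lborel)"

definition real_interpolation ::
  "'v::real_vector normed_subspace \<Rightarrow> 'v normed_subspace \<Rightarrow> real \<Rightarrow> real \<Rightarrow> 'v normed_subspace" where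
  "real_interpolation A\<^sub>0 A\<^sub>1 \<theta> p =
     \<lparr> elems = {f. (\<exists>a\<^sub>0\<in>elems A\<^sub>0. \<exists>a\<^sub>1\<in>elems A\<^sub>1. f = a\<^sub>0 + a\<^sub>1) \<and> K_integral A\<^sub>0 A\<^sub>1 \<theta> p f < \<infinity>},
       norm_on = (\<lambda>f. enn2real (K_integral A\<^sub>0 A\<^sub>1 \<theta> p f) powr (1 / p)) \<rparr>"

section \<open>Homogeneous Sobolev spaces\<close>

definition E_dot ::
  "('a \<Rightarrow> 'a \<Rightarrow> real) \<Rightarrow> ereal \<Rightarrow> ('a \<Rightarrow> 'k::{real_normed_field,banach}) set" where
  "E_dot \<mu> p = {f. grad \<mu> f \<in> Lp_space \<mu> p}"

definition W_dot ::
  "('a \<Rightarrow> 'a \<Rightarrow> real) \<Rightarrow> ereal \<Rightarrow>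
     ('a, 'k::{real_normed_field,banach}) fun_mod_const normed_subspace" where
  "W_dot \<mu> p =
     \<lparr> elems = mod_const ` E_dot \<mu> p,
       norm_on = (\<lambda>F. Lp_norm \<mu> p (grad_mod_const \<mu> F)) \<rparr>"

end

theory Submission imports Defs begin

text \<open>
  The gradient is sublinear, so one inclusion comes from reading off from a near-optimal
  decomposition of \<open>f\<close> at scale \<open>t\<close> that \<open>\<nabla>f\<close> cannot be large in \<open>L\<^sup>q\<close> where it exceeds
  \<open>4 K(t) / t\<close>.

  For the other inclusion, fix a level \<open>s\<close> and let \<open>\<Omega>\<close> be the set where the maximal function of
  \<open>|\<nabla>f|\<^sup>q\<close> exceeds \<open>s\<^sup>q\<close>.  No Whitney covering is needed: averaging \<open>f\<close> around \<open>x\<close> against the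
  weight \<open>max(0, d(x, \<Omega>\<^sup>c) + 1 - d(x, \<cdot>))\<close> leaves \<open>f\<close> unchanged off \<open>\<Omega>\<close>, and doubling together
  with the Poincare inequality makes the average Lipschitz with constant of order \<open>s\<close>.  Hence
  \<open>f\<close> splits as \<open>b\<close> plus a function with gradient of order \<open>s\<close>, where \<open>\<nabla>b\<close> lives on a
  neighbourhood of \<open>\<Omega>\<close>, and Vitali's covering argument gives
  \<open>\<parallel>\<nabla>b\<parallel>\<^sub>q\<^sup>q \<lesssim> H(s)\<close> with \<open>H(s)\<close> the integral of \<open>|\<nabla>f|\<^sup>q\<close> over \<open>{|\<nabla>f| > s / 2}\<close>.
  Thus \<open>K(t) \<lesssim> t s\<close> whenever \<open>H(s) \<le> s\<^sup>q t\<^sup>q\<close>, so that \<open>(K(t) / t)\<^sup>p\<close> is at most a constant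
  times the integral of \<open>s\<^sup>p\<^sup>-\<^sup>1\<close> over \<open>{s. H(s) > s\<^sup>q t\<^sup>q}\<close>, and Fubini's theorem finishes the proof.
\<close>

section \<open>Weighted graphs\<close>

context weighted_graph begin

section \<open>Paths, the graph metric and its balls\<close>

lemma adj_sym: "adj \<mu> x y \<Longrightarrow> adj \<mu> y x"
  by (simp add: adj_def weight_sym)

lemma joined_by_path_refl: "joined_by_path \<mu> 0 x x"
  unfolding joined_by_path_def by auto

lemma joined_by_path_adj: "adj \<mu> x y \<Longrightarrow> joined_by_path \<mu> 1 x y"
  unfolding joined_by_path_def by (intro exI[of _ "\<lambda>i. if i = 0 then x else y"]) auto

lemma joined_by_path_sym:
  assumes "joined_by_path \<mu> M x y"
  shows "joined_by_path \<mu> M y x"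
proof -
  obtain s where s: "s 0 = x" "s M = y" "\<And>i. i < M \<Longrightarrow> adj \<mu> (s i) (s (Suc i))"
    using assms unfolding joined_by_path_def by blast
  have "adj \<mu> (s (M - i)) (s (M - Suc i))" if "i < M" for i
    using adj_sym[OF s(3)[of "M - Suc i"]] that by (simp add: Suc_diff_Suc)
  then show ?thesis
    unfolding joined_by_path_def using s by (intro exI[of _ "\<lambda>i. s (M - i)"]) auto
qed

lemma joined_by_path_trans:
  assumes "joined_by_path \<mu> M x y" "joined_by_path \<mu> N y z"
  shows "joined_by_path \<mu> (M + N) x z"
proof -
  obtain s where s: "s 0 = x" "s M = y" "\<And>i. i < M \<Longrightarrow> adj \<mu> (s i) (s (Suc i))"
    using assms unfolding joined_by_path_def by blast
  obtain u where u: "u 0 = y" "u N = z" "\<And>i. i < N \<Longrightarrow> adj \<mu> (u i) (u (Suc i))"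
    using assms unfolding joined_by_path_def by blast
  define v where "v i = (if i \<le> M then s i else u (i - M))" for i
  have "adj \<mu> (v i) (v (Suc i))" if i: "i < M + N" for i
  proof -
    consider "i < M" | "i = M" | "i > M" by linarith
    then show ?thesis
    proof cases
      case 1
      then show ?thesis by (simp add: v_def s)
    next
      case 2
      then show ?thesis using u(3)[of 0] i by (simp add: v_def s u)
    next
      case 3
      then show ?thesis using u(3)[of "i - M"] i by (simp add: v_def Suc_diff_le)
    qed
  qed
  moreover have "v 0 = x" "v (M + N) = z"
    using s u by (auto simp: v_def)
  ultimately show ?thesis
    unfolding joined_by_path_def by blast
qed

lemma joined_by_path_graph_dist: "joined_by_path \<mu> (graph_dist \<mu> x y) x y"
  unfolding graph_dist_def using connected by (rule LeastI_ex)

lemma graph_dist_le: "joined_by_path \<mu> M x y \<Longrightarrow> graph_dist \<mu> x y \<le> M"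
  unfolding graph_dist_def by (rule Least_le)

lemma graph_dist_self [simp]: "graph_dist \<mu> x x = 0"
  using graph_dist_le[OF joined_by_path_refl] by simp

lemma graph_dist_eq_0_iff [simp]: "graph_dist \<mu> x y = 0 \<longleftrightarrow> x = y"
  using joined_by_path_graph_dist[of x y] by (auto simp: joined_by_path_def)

lemma graph_dist_sym: "graph_dist \<mu> x y = graph_dist \<mu> y x"
  using joined_by_path_sym[OF joined_by_path_graph_dist] by (intro antisym graph_dist_le)

lemma graph_dist_triangle: "graph_dist \<mu> x z \<le> graph_dist \<mu> x y + graph_dist \<mu> y z"
  by (rule graph_dist_le[OF joined_by_path_trans[OF joined_by_path_graph_dist joined_by_path_graph_dist]])

lemma graph_dist_adj: "adj \<mu> x y \<Longrightarrow> graph_dist \<mu> x y \<le> 1"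
  by (intro graph_dist_le joined_by_path_adj)

lemma mem_graph_ball: "y \<in> graph_ball \<mu> x r \<longleftrightarrow> real (graph_dist \<mu> x y) \<le> r"
  by (simp add: graph_ball_def)

lemma graph_ball_subset:
  assumes "real (graph_dist \<mu> y x) + r \<le> s"
  shows "graph_ball \<mu> x r \<subseteq> graph_ball \<mu> y s"
proof
  fix z assume "z \<in> graph_ball \<mu> x r"
  then show "z \<in> graph_ball \<mu> y s"
    using graph_dist_triangle[of y z x] assms by (simp add: mem_graph_ball)
qed

text \<open>Distances are integers. Together with doubling at radius 1/2 this bounds the volume of a
  unit ball by the weight of its centre.\<close>

lemma graph_ball_small: "0 \<le> r \<Longrightarrow> r < 1 \<Longrightarrow> graph_ball \<mu> x r = {x}"
proof -
  assume "0 \<le> r" "r < 1"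
  then have eq: "real n \<le> r \<longleftrightarrow> n = 0" for n :: nat
    using of_nat_mono[of 1 n, where 'a = real] by (cases "n = 0") (simp, linarith)
  show ?thesis
    unfolding graph_ball_def eq graph_dist_eq_0_iff by auto
qed

text \<open>Induction on the radius: the last but one vertex of a geodesic of length
  \<open>Suc n\<close> is at distance at most \<open>n\<close> from \<open>x\<close>, so the larger
  ball is covered by finitely many unit balls.\<close>

lemma finite_graph_ball: "finite (graph_ball \<mu> x r)"
proof -
  have "finite {y. graph_dist \<mu> x y \<le> n}" for n
  proof (induction n)
    case 0
    then show ?case by simp
  next
    case (Suc n)
    have "{y. graph_dist \<mu> x y \<le> Suc n}
        \<subseteq> {y. graph_dist \<mu> x y \<le> n} \<union> (\<Union>z\<in>{y. graph_dist \<mu> x y \<le> n}. graph_ball \<mu> z 1)"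
    proof
      fix y assume "y \<in> {y. graph_dist \<mu> x y \<le> Suc n}"
      then consider "graph_dist \<mu> x y \<le> n" | "graph_dist \<mu> x y = Suc n" by force
      then show "y \<in> {y. graph_dist \<mu> x y \<le> n} \<union> (\<Union>z\<in>{y. graph_dist \<mu> x y \<le> n}. graph_ball \<mu> z 1)"
      proof cases
        case 2
        then obtain s where s: "s 0 = x" "s (Suc n) = y" "\<And>i. i < Suc n \<Longrightarrow> adj \<mu> (s i) (s (Suc i))"
          using joined_by_path_graph_dist[of x y] unfolding joined_by_path_def by auto
        have "joined_by_path \<mu> n x (s n)"
          unfolding joined_by_path_def using s by (intro exI[of _ s]) auto
        then have "graph_dist \<mu> x (s n) \<le> n" by (rule graph_dist_le)
        moreover have "y \<in> graph_ball \<mu> (s n) 1"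
          using graph_dist_adj[OF s(3)[of n]] s(2) by (simp add: mem_graph_ball)
        ultimately show ?thesis by blast
      qed auto
    qed
    moreover have "finite (graph_ball \<mu> z 1)" for z
      using locally_uniformly_finite by blast
    ultimately show ?case
      using Suc by (meson finite_UN finite_Un finite_subset)
  qed
  moreover have "graph_ball \<mu> x r \<subseteq> {y. graph_dist \<mu> x y \<le> nat \<lfloor>r\<rfloor>}"
    by (auto simp: mem_graph_ball intro: le_nat_floor)
  ultimately show ?thesis by (rule finite_subset[rotated])
qed

text \<open>Makes counting measure on the vertices sigma-finite, so that Tonelli applies to it, and
  allows the vertices to be enumerated.\<close>

lemma countable_vertices: "countable (UNIV :: 'a set)"
proof -
  fix x
  have "countable (\<Union>n::nat. graph_ball \<mu> x (real n))"
    by (rule countable_UN[OF countableI_type countable_finite[OF finite_graph_ball]])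
  moreover have "y \<in> graph_ball \<mu> x (real (graph_dist \<mu> x y))" for y
    by (simp add: mem_graph_ball)
  then have "(\<Union>n::nat. graph_ball \<mu> x (real n)) = UNIV"
    by blast
  ultimately show ?thesis by simp
qed

section \<open>Volumes, and the gradient as a weighted Euclidean norm\<close>

lemma vertex_weight_nonneg [simp]: "0 \<le> vertex_weight \<mu> x"
  using vertex_weight_pos less_imp_le by blast

lemma volume_nonneg [simp]: "0 \<le> volume \<mu> A"
  unfolding volume_def by (intro sum_nonneg) simp

lemma volume_mono: "finite B \<Longrightarrow> A \<subseteq> B \<Longrightarrow> volume \<mu> A \<le> volume \<mu> B"
  unfolding volume_def by (intro sum_mono2) auto

lemma volume_graph_ball_mono:
  "real (graph_dist \<mu> y x) + r \<le> s \<Longrightarrow> volume \<mu> (graph_ball \<mu> x r) \<le> volume \<mu> (graph_ball \<mu> y s)"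
  by (intro volume_mono finite_graph_ball graph_ball_subset)

lemma volume_graph_ball_pos: "0 \<le> r \<Longrightarrow> 0 < volume \<mu> (graph_ball \<mu> x r)"
  unfolding volume_def
  by (rule sum_pos2[OF finite_graph_ball, of x]) (auto simp: mem_graph_ball vertex_weight_pos)

lemma transition_nonneg: "0 \<le> transition \<mu> x y"
  unfolding transition_def using weight_nonneg by simp

lemma sum_transition: "(\<Sum>y | adj \<mu> x y. transition \<mu> x y) = 1"
  using vertex_weight_pos[of x]
  by (simp add: transition_def vertex_weight_def flip: sum_divide_distrib)

lemma grad_nonneg [simp]: "0 \<le> grad \<mu> f x"
  unfolding grad_def by (simp add: sum_nonneg transition_nonneg)

text \<open>In this form the subadditivity of the gradient is Minkowski's inequality.\<close>

lemma grad_eq_L2_set: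
  "grad \<mu> f x = L2_set (\<lambda>y. sqrt (transition \<mu> x y / 2) * norm (f y - f x)) {y. adj \<mu> x y}"
  unfolding grad_def L2_set_def
  by (simp add: power_mult_distrib transition_nonneg sum_distrib_left)

lemma grad_add_le: "grad \<mu> (\<lambda>x. f x + h x) x \<le> grad \<mu> f x + grad \<mu> h x"
proof -
  let ?N = "{y. adj \<mu> x y}" and ?s = "\<lambda>y. sqrt (transition \<mu> x y / 2)"
  have "grad \<mu> (\<lambda>x. f x + h x) x
      \<le> L2_set (\<lambda>y. ?s y * norm (f y - f x) + ?s y * norm (h y - h x)) ?N"
    unfolding grad_eq_L2_set
  proof (intro L2_set_mono)
    fix y
    have "f y + h y - (f x + h x) = (f y - f x) + (h y - h x)" by simp
    then have "norm (f y + h y - (f x + h x)) \<le> norm (f y - f x) + norm (h y - h x)"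
      by (metis norm_triangle_ineq)
    then show "?s y * norm (f y + h y - (f x + h x))
        \<le> ?s y * norm (f y - f x) + ?s y * norm (h y - h x)"
      by (simp add: transition_nonneg mult_left_mono flip: distrib_left)
  qed (simp add: transition_nonneg)
  also have "\<dots> \<le> grad \<mu> f x + grad \<mu> h x"
    unfolding grad_eq_L2_set by (rule L2_set_triangle_ineq)
  finally show ?thesis .
qed

lemma grad_uminus: "grad \<mu> (\<lambda>x. - f x) = grad \<mu> f"
  unfolding grad_def by (simp add: norm_minus_commute)

text \<open>The transition probabilities sum to one, so the squared gradient is half of a mean of
  squared edge differences; the factor 1/2 is discarded.\<close>

lemma grad_le_of_edges:
  assumes "\<And>y. adj \<mu> x y \<Longrightarrow> norm (f y - f x) \<le> c" and "0 \<le> c"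
  shows "grad \<mu> f x \<le> c"
proof -
  have "(\<Sum>y | adj \<mu> x y. transition \<mu> x y * (norm (f y - f x))\<^sup>2)
      \<le> (\<Sum>y | adj \<mu> x y. transition \<mu> x y * c\<^sup>2)"
    by (intro sum_mono mult_left_mono power_mono) (auto simp: assms transition_nonneg)
  also have "\<dots> = c\<^sup>2"
    by (simp add: sum_transition flip: sum_distrib_right)
  finally have "grad \<mu> f x \<le> sqrt (c\<^sup>2)"
    unfolding grad_def by (intro real_sqrt_le_mono) (use zero_le_power2[of c] in linarith)
  then show ?thesis using assms(2) by simp
qed

text \<open>Greedy selection: keep a ball of largest radius, drop every ball that meets it, and
  recurse on the rest. A dropped ball has no larger radius, so its centre lies in the tripled
  selected ball.\<close>

lemma finite_graph_vitali:
  assumes "finite A" and "\<And>x. x \<in> A \<Longrightarrow> 0 < r x"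
  shows "\<exists>A'\<subseteq>A. disjoint_family_on (\<lambda>x. graph_ball \<mu> x (r x)) A'
           \<and> A \<subseteq> (\<Union>x\<in>A'. graph_ball \<mu> x (3 * r x))"
  using assms
proof (induction A rule: finite_psubset_induct)
  case (psubset A)
  show ?case
  proof (cases "A = {}")
    case False
    obtain x where x: "x \<in> A" "\<And>y. y \<in> A \<Longrightarrow> r y \<le> r x"
    proof -
      have "Max (r ` A) \<in> r ` A"
        using psubset.hyps False by simp
      then obtain x where "x \<in> A" "r x = Max (r ` A)" by force
      then show ?thesis using that[of x] psubset.hyps by simp
    qed
    define A1 where "A1 = {y \<in> A. graph_ball \<mu> y (r y) \<inter> graph_ball \<mu> x (r x) = {}}"
    have "x \<notin> A1"
      using psubset.prems[OF x(1)] mem_graph_ball[of x x "r x"] by (auto simp: A1_def)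
    then have "A1 \<subset> A"
      using x(1) by (auto simp: A1_def)
    then obtain A' where A': "A' \<subseteq> A1" "disjoint_family_on (\<lambda>x. graph_ball \<mu> x (r x)) A'"
        "A1 \<subseteq> (\<Union>x\<in>A'. graph_ball \<mu> x (3 * r x))"
      using psubset.IH[of A1] psubset.prems by auto
    have "y \<in> graph_ball \<mu> x (3 * r x)" if y: "y \<in> A" "y \<notin> A1" for y
    proof -
      obtain z where "real (graph_dist \<mu> y z) \<le> r y" "real (graph_dist \<mu> x z) \<le> r x"
        using y by (auto simp: A1_def mem_graph_ball)
      then show ?thesis
        using graph_dist_triangle[of x y z] graph_dist_sym[of y z] x(2)[OF y(1)]
          psubset.prems[OF x(1)] by (simp add: mem_graph_ball)
    qed
    moreover have "disjoint_family_on (\<lambda>x. graph_ball \<mu> x (r x)) (insert x A')"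
      using A'(1,2) \<open>x \<notin> A1\<close> unfolding A1_def by (subst disjoint_family_on_insert) auto
    ultimately show ?thesis
      using A'(1,3) x(1) \<open>A1 \<subset> A\<close>
      by (intro exI[of _ "insert x A'"] conjI) auto
  qed (simp add: disjoint_family_on_def)
qed

end

section \<open>Averages and the maximal function\<close>

text \<open>A substitute for Jensen's inequality, passing from an \<open>L\<^sup>q\<close> mean to
  an \<open>L\<^sup>1\<close> mean at the cost of a factor 2 through a pointwise inequality.\<close>

lemma weighted_sum_le_of_power_sum_le:
  fixes u w :: "'b \<Rightarrow> real"
  assumes "1 \<le> q" "0 < \<epsilon>" and nonneg: "\<And>x. x \<in> B \<Longrightarrow> 0 \<le> u x" "\<And>x. x \<in> B \<Longrightarrow> 0 \<le> w x"
    and le: "(\<Sum>x\<in>B. u x powr q * w x) \<le> \<epsilon> powr q * (\<Sum>x\<in>B. w x)"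
  shows "(\<Sum>x\<in>B. u x * w x) \<le> 2 * \<epsilon> * (\<Sum>x\<in>B. w x)"
proof -
  \<comment> \<open>Above \<open>\<epsilon>\<close>, write \<open>v\<close> as
    \<open>v powr (1 - q) * v powr q\<close> and use that the exponent \<open>1 - q\<close> is not
    positive.\<close>
  have *: "v \<le> \<epsilon> + \<epsilon> powr (1 - q) * v powr q" if "0 \<le> v" for v
  proof (cases "v \<le> \<epsilon>")
    case False
    then have "v powr (1 - q) \<le> \<epsilon> powr (1 - q)"
      using assms(1,2) by (intro powr_mono2') auto
    then have "v powr (1 - q) * v powr q \<le> \<epsilon> powr (1 - q) * v powr q"
      by (intro mult_right_mono) auto
    moreover have "v powr (1 - q) * v powr q = v"
      using False assms(2) by (simp flip: powr_add)
    ultimately show ?thesis using assms(2) by linarith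
  qed (simp add: add_increasing2)
  have "(\<Sum>x\<in>B. u x * w x) \<le> (\<Sum>x\<in>B. (\<epsilon> + \<epsilon> powr (1 - q) * u x powr q) * w x)"
    by (intro sum_mono mult_right_mono * nonneg)
  also have "\<dots> = \<epsilon> * (\<Sum>x\<in>B. w x) + \<epsilon> powr (1 - q) * (\<Sum>x\<in>B. u x powr q * w x)"
    by (simp add: distrib_right sum.distrib sum_distrib_left mult.assoc)
  also have "\<dots> \<le> \<epsilon> * (\<Sum>x\<in>B. w x) + \<epsilon> powr (1 - q) * (\<epsilon> powr q * (\<Sum>x\<in>B. w x))"
    by (intro add_left_mono mult_left_mono le) auto
  also have "\<epsilon> powr (1 - q) * (\<epsilon> powr q * (\<Sum>x\<in>B. w x)) = \<epsilon> * (\<Sum>x\<in>B. w x)"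
    using assms(2) by (simp flip: mult.assoc powr_add)
  finally show ?thesis by simp
qed

text \<open>Centred at the second mean, the \<open>w2\<close>-weighted sum vanishes, so
  \<open>w1\<close> may be replaced by \<open>w1 - w2\<close>, which is bounded independently of
  \<open>R\<close>. Since \<open>S1\<close> will be of order \<open>R\<close> times the volume,
  dividing by it later gains a factor \<open>1 / R\<close>.\<close>

lemma kernel_average_diff:
  fixes B :: "'b set" and f :: "'b \<Rightarrow> 'c::real_normed_vector" and m w1 w2 :: "'b \<Rightarrow> real"
  defines "S1 \<equiv> \<Sum>z\<in>B. w1 z * m z" and "S2 \<equiv> \<Sum>z\<in>B. w2 z * m z"
  assumes m: "\<And>z. z \<in> B \<Longrightarrow> 0 \<le> m z" and V: "0 < (\<Sum>z\<in>B. m z)"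
    and S1: "0 < S1"
    and w: "\<And>z. z \<in> B \<Longrightarrow> \<bar>w1 z - w2 z\<bar> \<le> 2"
    and w2: "\<And>z. z \<in> B \<Longrightarrow> 0 \<le> w2 z" "\<And>z. z \<in> B \<Longrightarrow> w2 z \<le> R"
    and R: "0 < R" and \<kappa>: "0 < \<kappa>" and S2: "\<kappa> * R * (\<Sum>z\<in>B. m z) \<le> S2"
  shows "S1 * norm ((1 / S1) *\<^sub>R (\<Sum>z\<in>B. (w1 z * m z) *\<^sub>R f z)
                  - (1 / S2) *\<^sub>R (\<Sum>z\<in>B. (w2 z * m z) *\<^sub>R f z))
         \<le> 2 * (1 + 1 / \<kappa>) * (\<Sum>z\<in>B. norm (f z - c) * m z)"
proof -
  let ?V = "\<Sum>z\<in>B. m z" and ?A = "\<Sum>z\<in>B. norm (f z - c) * m z"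
  define a1 where "a1 = (1 / S1) *\<^sub>R (\<Sum>z\<in>B. (w1 z * m z) *\<^sub>R f z)"
  define a2 where "a2 = (1 / S2) *\<^sub>R (\<Sum>z\<in>B. (w2 z * m z) *\<^sub>R f z)"
  have "0 < \<kappa> * R * ?V" using R \<kappa> V by simp
  then have S2_pos: "0 < S2" using S2 by linarith
  have A: "0 \<le> ?A" using m by (intro sum_nonneg) simp
  \<comment> \<open>Used twice: with \<open>b = c\<close> it bounds the distance from
    \<open>a2\<close> to \<open>c\<close>, and with \<open>b = a2\<close> the sum is zero.\<close>
  have centre: "(\<Sum>z\<in>B. (w2 z * m z) *\<^sub>R (f z - b)) = S2 *\<^sub>R (a2 - b)" for b
    using S2_pos by (simp add: a2_def scaleR_diff_right sum_subtractf S2_def flip: scaleR_sum_left)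
  have "S2 * norm (a2 - c) = norm (\<Sum>z\<in>B. (w2 z * m z) *\<^sub>R (f z - c))"
    using S2_pos by (simp add: centre)
  also have "\<dots> \<le> (\<Sum>z\<in>B. R * (norm (f z - c) * m z))"
  proof (intro sum_norm_le)
    fix z assume z: "z \<in> B"
    have "w2 z * (norm (f z - c) * m z) \<le> R * (norm (f z - c) * m z)"
      using w2(2)[OF z] m[OF z] by (intro mult_right_mono) auto
    then show "norm ((w2 z * m z) *\<^sub>R (f z - c)) \<le> R * (norm (f z - c) * m z)"
      using w2(1)[OF z] m[OF z] by (simp add: abs_mult mult_ac)
  qed
  also have "\<dots> = R * ?A"
    by (simp add: sum_distrib_left)
  finally have "S2 * norm (a2 - c) \<le> R * ?A" .
  moreover have "\<kappa> * R * ?V * norm (a2 - c) \<le> S2 * norm (a2 - c)"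
    using S2 by (intro mult_right_mono) auto
  ultimately have "R * (\<kappa> * (?V * norm (a2 - c))) \<le> R * ?A"
    by (simp add: mult_ac)
  then have a2c: "?V * norm (a2 - c) \<le> ?A / \<kappa>"
    using R \<kappa> by (simp add: field_simps)
  have "S1 *\<^sub>R (a1 - a2) = (\<Sum>z\<in>B. (w1 z * m z) *\<^sub>R (f z - a2))"
    using S1 by (simp add: a1_def scaleR_diff_right sum_subtractf S1_def flip: scaleR_sum_left)
  also have "\<dots> = (\<Sum>z\<in>B. (w1 z * m z) *\<^sub>R (f z - a2)) - (\<Sum>z\<in>B. (w2 z * m z) *\<^sub>R (f z - a2))"
    using centre[of a2] by simp
  also have "\<dots> = (\<Sum>z\<in>B. ((w1 z - w2 z) * m z) *\<^sub>R (f z - a2))"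
    by (simp add: left_diff_distrib scaleR_diff_left sum_subtractf)
  finally have "S1 * norm (a1 - a2) = norm (\<Sum>z\<in>B. ((w1 z - w2 z) * m z) *\<^sub>R (f z - a2))"
    using S1 by (metis abs_of_pos norm_scaleR)
  also have "\<dots> \<le> (\<Sum>z\<in>B. 2 * (norm (f z - c) * m z) + 2 * (m z * norm (a2 - c)))"
  proof (intro sum_norm_le)
    fix z assume z: "z \<in> B"
    have "norm (((w1 z - w2 z) * m z) *\<^sub>R (f z - a2)) = \<bar>w1 z - w2 z\<bar> * (m z * norm (f z - a2))"
      using m[OF z] by (simp add: abs_mult)
    also have "\<dots> \<le> 2 * (m z * norm (f z - a2))"
      using w[OF z] m[OF z] by (intro mult_right_mono) auto
    also have "\<dots> \<le> 2 * (m z * (norm (f z - c) + norm (a2 - c)))"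
      using m[OF z] norm_triangle_ineq4[of "f z - c" "a2 - c"]
      by (intro mult_left_mono) auto
    finally show "norm (((w1 z - w2 z) * m z) *\<^sub>R (f z - a2))
        \<le> 2 * (norm (f z - c) * m z) + 2 * (m z * norm (a2 - c))"
      by (simp add: algebra_simps)
  qed
  also have "\<dots> = 2 * ?A + 2 * (?V * norm (a2 - c))"
    by (simp add: sum.distrib sum_distrib_left sum_distrib_right)
  also have "\<dots> \<le> 2 * (1 + 1 / \<kappa>) * ?A"
    using a2c by (simp add: algebra_simps)
  finally show ?thesis by (simp add: a1_def a2_def)
qed

context weighted_graph begin

lemma volume_UN_le:
  assumes "finite I" "\<And>i. i \<in> I \<Longrightarrow> finite (B i)"
  shows "volume \<mu> (\<Union>i\<in>I. B i) \<le> (\<Sum>i\<in>I. volume \<mu> (B i))"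
  using assms
proof (induction I rule: finite_induct)
  case (insert i I)
  have "volume \<mu> (B i \<union> (\<Union>i\<in>I. B i)) \<le> volume \<mu> (B i) + volume \<mu> (\<Union>i\<in>I. B i)"
    using insert.prems insert.hyps(1) volume_nonneg[of "B i \<inter> (\<Union>i\<in>I. B i)"]
    unfolding volume_def by (subst sum.union_inter[symmetric]) auto
  then show ?case using insert by force
qed (simp add: volume_def)

end

text \<open>Truncation at height \<open>s / 2\<close>: as \<open>q \<ge> 1\<close>, the low part
  uses up only half of the level \<open>s powr q\<close>.\<close>

lemma half_powr_le: 
  assumes "1 \<le> q" "0 \<le> v" "0 < s" "v \<le> s / 2"
  shows "v powr q \<le> s powr q / (2::real)"
proof -
  have "v powr q \<le> (s / 2) powr q"
    using assms by (intro powr_mono2) auto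
  also have "\<dots> = s powr q / 2 powr q"
    using assms by (simp add: powr_divide)
  also have "\<dots> \<le> s powr q / 2"
    using assms powr_mono[of 1 q 2] by (intro divide_left_mono) auto
  finally show ?thesis .
qed

section \<open>Volume comparison and the weak type estimate for the maximal function\<close>

locale doubling_graph = weighted_graph +
  fixes D :: real
  assumes D_ge_1: "1 \<le> D"
    and volume_doubling: "0 < r \<Longrightarrow> volume \<mu> (graph_ball \<mu> x (2 * r)) \<le> D * volume \<mu> (graph_ball \<mu> x r)"
begin

lemma volume_doubling_power:
  assumes "0 < r"
  shows "volume \<mu> (graph_ball \<mu> x (2 ^ n * r)) \<le> D ^ n * volume \<mu> (graph_ball \<mu> x r)"
proof (induction n)
  case (Suc n)
  have "volume \<mu> (graph_ball \<mu> x (2 * (2 ^ n * r))) \<le> D * volume \<mu> (graph_ball \<mu> x (2 ^ n * r))"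
    using assms by (intro volume_doubling) simp
  also have "\<dots> \<le> D * (D ^ n * volume \<mu> (graph_ball \<mu> x r))"
    using Suc D_ge_1 by (intro mult_left_mono) auto
  finally show ?case by (simp add: mult.assoc)
qed simp

lemma volume_compare:
  assumes "0 < r" and "real (graph_dist \<mu> x y) + s \<le> 2 ^ n * r"
  shows "volume \<mu> (graph_ball \<mu> y s) \<le> D ^ n * volume \<mu> (graph_ball \<mu> x r)"
  using volume_graph_ball_mono[OF assms(2)] volume_doubling_power[OF assms(1)] by (rule order_trans)

text \<open>Vitali selects disjoint balls whose triples cover \<open>A\<close>; each triple lies in
  the ball of radius \<open>2\<^sup>2 * r\<close>, hence the factor \<open>D\<^sup>2\<close>. The
  number \<open>H\<close> stands for the integral of \<open>h\<close>, expressed through finite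
  partial sums.\<close>

lemma maximal_weak_type:
  assumes "finite A" "0 \<le> s" "\<And>y. 0 \<le> h y"
    and A: "\<And>x. x \<in> A \<Longrightarrow> \<exists>r>0. s * volume \<mu> (graph_ball \<mu> x r) \<le> (\<Sum>y\<in>graph_ball \<mu> x r. h y * vertex_weight \<mu> y)"
    and H: "\<And>F. finite F \<Longrightarrow> (\<Sum>y\<in>F. h y * vertex_weight \<mu> y) \<le> H"
  shows "s * volume \<mu> A \<le> D\<^sup>2 * H"
proof -
  obtain r where r: "\<And>x. x \<in> A \<Longrightarrow> 0 < r x"
      "\<And>x. x \<in> A \<Longrightarrow> s * volume \<mu> (graph_ball \<mu> x (r x))
         \<le> (\<Sum>y\<in>graph_ball \<mu> x (r x). h y * vertex_weight \<mu> y)"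
    using A by metis
  obtain A' where A': "A' \<subseteq> A" "disjoint_family_on (\<lambda>x. graph_ball \<mu> x (r x)) A'"
      "A \<subseteq> (\<Union>x\<in>A'. graph_ball \<mu> x (3 * r x))"
    using finite_graph_vitali[OF assms(1), of r] r(1) by blast
  have fin: "finite A'" using A'(1) assms(1) by (rule finite_subset)
  have "volume \<mu> A \<le> volume \<mu> (\<Union>x\<in>A'. graph_ball \<mu> x (3 * r x))"
    using A'(3) fin by (intro volume_mono) (auto simp: finite_graph_ball)
  also have "\<dots> \<le> (\<Sum>x\<in>A'. volume \<mu> (graph_ball \<mu> x (3 * r x)))"
    by (intro volume_UN_le fin finite_graph_ball)
  also have "\<dots> \<le> (\<Sum>x\<in>A'. D\<^sup>2 * volume \<mu> (graph_ball \<mu> x (r x)))"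
    using A'(1) r(1) by (intro sum_mono volume_compare) (force simp: less_imp_le)+
  finally have "s * volume \<mu> A \<le> s * (\<Sum>x\<in>A'. D\<^sup>2 * volume \<mu> (graph_ball \<mu> x (r x)))"
    using assms(2) by (rule mult_left_mono)
  also have "\<dots> = D\<^sup>2 * (\<Sum>x\<in>A'. s * volume \<mu> (graph_ball \<mu> x (r x)))"
    by (simp add: sum_distrib_left mult_ac)
  also have "\<dots> \<le> D\<^sup>2 * (\<Sum>x\<in>A'. \<Sum>y\<in>graph_ball \<mu> x (r x). h y * vertex_weight \<mu> y)"
    using A'(1) r(2) by (intro mult_left_mono sum_mono) auto
  also have "(\<Sum>x\<in>A'. \<Sum>y\<in>graph_ball \<mu> x (r x). h y * vertex_weight \<mu> y)
      = (\<Sum>y\<in>(\<Union>x\<in>A'. graph_ball \<mu> x (r x)). h y * vertex_weight \<mu> y)"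
    using A'(2) fin by (intro sum.UNION_disjoint[symmetric])
      (auto simp: finite_graph_ball disjoint_family_on_def)
  also have "\<dots> \<le> H"
    using fin by (intro H) (simp add: finite_graph_ball)
  finally show ?thesis using D_ge_1 by (simp add: mult_left_mono)
qed

text \<open>The superlevel set, at height \<open>s powr q\<close>, of the centred maximal function
  of \<open>g powr q\<close>, with the volume multiplied out.\<close>

definition bad_set :: "('a \<Rightarrow> real) \<Rightarrow> real \<Rightarrow> real \<Rightarrow> 'a set" where
  "bad_set g q s = {x. \<exists>r>0. s powr q * volume \<mu> (graph_ball \<mu> x r)
     < (\<Sum>y\<in>graph_ball \<mu> x r. g y powr q * vertex_weight \<mu> y)}"

lemma not_bad_setD:
  assumes "x \<notin> bad_set g q s" "0 < r"
  shows "(\<Sum>y\<in>graph_ball \<mu> x r. g y powr q * vertex_weight \<mu> y) \<le> s powr q * volume \<mu> (graph_ball \<mu> x r)"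
  using assms unfolding bad_set_def by force

text \<open>The part of \<open>g\<close> below \<open>s / 2\<close> has averages of its
  \<open>q\<close>-th power at most \<open>s powr q / 2\<close>, so on the bad set the part above
  \<open>s / 2\<close> must supply the other half; the weak type bound is applied to that part
  alone.\<close>

lemma volume_bad_set_le:
  assumes "1 \<le> q" "0 < s" "\<And>y. 0 \<le> g y" "finite A" "A \<subseteq> bad_set g q s"
    and H: "\<And>F. finite F \<Longrightarrow> (\<Sum>y\<in>{y\<in>F. s / 2 < g y}. g y powr q * vertex_weight \<mu> y) \<le> H"
  shows "s powr q * volume \<mu> A \<le> 2 * D\<^sup>2 * H"
proof -
  define h where "h y = (if s / 2 < g y then g y powr q else 0)" for y
  have "s powr q / 2 * volume \<mu> A \<le> D\<^sup>2 * H"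
  proof (rule maximal_weak_type[where h = h])
    fix x assume "x \<in> A"
    then obtain r where r: "0 < r" "s powr q * volume \<mu> (graph_ball \<mu> x r)
        < (\<Sum>y\<in>graph_ball \<mu> x r. g y powr q * vertex_weight \<mu> y)"
      using assms(5) by (auto simp: bad_set_def)
    have "g y powr q \<le> h y + s powr q / 2" for y
      using half_powr_le[of q "g y" s] assms(1,2,3) by (auto simp: h_def)
    then have "(\<Sum>y\<in>graph_ball \<mu> x r. g y powr q * vertex_weight \<mu> y)
        \<le> (\<Sum>y\<in>graph_ball \<mu> x r. (h y + s powr q / 2) * vertex_weight \<mu> y)"
      by (intro sum_mono mult_right_mono) auto
    also have "\<dots> = (\<Sum>y\<in>graph_ball \<mu> x r. h y * vertex_weight \<mu> y)
        + s powr q / 2 * volume \<mu> (graph_ball \<mu> x r)"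
      by (simp add: distrib_right sum.distrib sum_distrib_left volume_def)
    finally show "\<exists>r>0. s powr q / 2 * volume \<mu> (graph_ball \<mu> x r)
        \<le> (\<Sum>y\<in>graph_ball \<mu> x r. h y * vertex_weight \<mu> y)"
      using r by (intro exI[of _ r]) simp
  next
    fix F :: "'a set" assume F: "finite F"
    have "(\<Sum>y\<in>F. h y * vertex_weight \<mu> y)
        = (\<Sum>y\<in>F. if s / 2 < g y then g y powr q * vertex_weight \<mu> y else 0)"
      by (intro sum.cong) (auto simp: h_def)
    also have "\<dots> = (\<Sum>y\<in>{y\<in>F. s / 2 < g y}. g y powr q * vertex_weight \<mu> y)"
      using F by (simp add: sum.inter_filter)
    finally show "(\<Sum>y\<in>F. h y * vertex_weight \<mu> y) \<le> H"
      using H[OF F] by simp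
  qed (use assms in \<open>auto simp: h_def\<close>)
  then show ?thesis by simp
qed

end

section \<open>Smoothing at the scale of the distance to a set\<close>

context weighted_graph begin

definition dist_to :: "'a set \<Rightarrow> 'a \<Rightarrow> nat" where
  "dist_to F x = (LEAST n. \<exists>z\<in>F. graph_dist \<mu> x z = n)"

lemma dist_to_attained:
  assumes "F \<noteq> {}"
  obtains z where "z \<in> F" "graph_dist \<mu> x z = dist_to F x"
proof -
  have "\<exists>n. \<exists>z\<in>F. graph_dist \<mu> x z = n" using assms by blast
  then have "\<exists>z\<in>F. graph_dist \<mu> x z = dist_to F x"
    unfolding dist_to_def by (rule LeastI_ex)
  then show ?thesis using that by blast
qed

lemma dist_to_le: "z \<in> F \<Longrightarrow> dist_to F x \<le> graph_dist \<mu> x z"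
  unfolding dist_to_def by (rule Least_le) blast

lemma dist_to_eq_0: "x \<in> F \<Longrightarrow> dist_to F x = 0"
  using dist_to_le[of x F x] by simp

lemma dist_to_triangle:
  assumes "F \<noteq> {}"
  shows "dist_to F x \<le> graph_dist \<mu> x y + dist_to F y"
proof -
  obtain z where "z \<in> F" "graph_dist \<mu> y z = dist_to F y"
    using assms by (rule dist_to_attained)
  then show ?thesis
    using dist_to_le[of z F x] graph_dist_triangle[of x z y] by simp
qed

text \<open>The added 1 keeps the radius positive; on \<open>F\<close> the radius is exactly 1, so
  the tent of \<open>kernel\<close> charges only its centre there.\<close>

definition radius :: "'a set \<Rightarrow> 'a \<Rightarrow> real" where
  "radius F x = real (dist_to F x) + 1"

text \<open>A tent instead of an indicator: its height grows with the radius, while passing to a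
  neighbouring centre changes its values only by a bounded amount.\<close>

definition kernel :: "'a set \<Rightarrow> 'a \<Rightarrow> 'a \<Rightarrow> real" where
  "kernel F x z = max 0 (radius F x - real (graph_dist \<mu> x z))"

definition smoothing :: "'a set \<Rightarrow> ('a \<Rightarrow> 'k::{real_normed_field,banach}) \<Rightarrow> 'a \<Rightarrow> 'k" where
  "smoothing F f x =
     (1 / (\<Sum>z\<in>graph_ball \<mu> x (radius F x). kernel F x z * vertex_weight \<mu> z)) *\<^sub>R
       (\<Sum>z\<in>graph_ball \<mu> x (radius F x). (kernel F x z * vertex_weight \<mu> z) *\<^sub>R f z)"

lemma radius_ge_1: "1 \<le> radius F x"
  by (simp add: radius_def)

lemma kernel_nonneg: "0 \<le> kernel F x z"
  by (simp add: kernel_def)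

lemma kernel_le_radius: "kernel F x z \<le> radius F x"
  using radius_ge_1[of F x] by (simp add: kernel_def)

lemma kernel_eq_0: "z \<notin> graph_ball \<mu> x (radius F x) \<Longrightarrow> kernel F x z = 0"
  by (simp add: kernel_def mem_graph_ball)

text \<open>The kernel vanishes off its ball, so the means at two neighbouring vertices can be
  written as sums over one common set.\<close>

lemma smoothing_superset:
  assumes "graph_ball \<mu> x (radius F x) \<subseteq> B" "finite B"
  shows "smoothing F f x = (1 / (\<Sum>z\<in>B. kernel F x z * vertex_weight \<mu> z)) *\<^sub>R
       (\<Sum>z\<in>B. (kernel F x z * vertex_weight \<mu> z) *\<^sub>R f z)"
proof -
  have "(\<Sum>z\<in>graph_ball \<mu> x (radius F x). kernel F x z * vertex_weight \<mu> z)
      = (\<Sum>z\<in>B. kernel F x z * vertex_weight \<mu> z)"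
    using assms by (intro sum.mono_neutral_left) (auto simp: kernel_eq_0)
  moreover have "(\<Sum>z\<in>graph_ball \<mu> x (radius F x). (kernel F x z * vertex_weight \<mu> z) *\<^sub>R f z)
      = (\<Sum>z\<in>B. (kernel F x z * vertex_weight \<mu> z) *\<^sub>R f z)"
    using assms by (intro sum.mono_neutral_left) (auto simp: kernel_eq_0)
  ultimately show ?thesis by (simp add: smoothing_def)
qed

lemma smoothing_eq:
  assumes "x \<in> F"
  shows "smoothing F f x = f x"
proof -
  let ?B = "graph_ball \<mu> x (radius F x)"
  have "kernel F x z = (if z = x then 1 else 0)" for z
    using graph_dist_eq_0_iff[of x z] dist_to_eq_0[OF assms]
    by (cases "graph_dist \<mu> x z") (auto simp: kernel_def radius_def)
  moreover have "x \<in> ?B"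
    using radius_ge_1[of F x] by (simp add: mem_graph_ball)
  ultimately show ?thesis
    using vertex_weight_pos[of x] finite_graph_ball[of x "radius F x"]
    by (simp add: smoothing_def if_distrib[of "\<lambda>u. u * _"] if_distrib[of "\<lambda>u. u *\<^sub>R _"]
          sum.delta cong: if_cong)
qed

lemma adj_radius_diff:
  assumes "F \<noteq> {}" "adj \<mu> x y"
  shows "\<bar>radius F x - radius F y\<bar> \<le> 1"
  using dist_to_triangle[OF assms(1), of x y] dist_to_triangle[OF assms(1), of y x]
    graph_dist_adj[OF assms(2)] graph_dist_adj[OF adj_sym[OF assms(2)]]
  by (simp add: radius_def)

lemma adj_kernel_diff:
  assumes "F \<noteq> {}" "adj \<mu> x y"
  shows "\<bar>kernel F x z - kernel F y z\<bar> \<le> 2"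
proof -
  have "\<bar>real (graph_dist \<mu> x z) - real (graph_dist \<mu> y z)\<bar> \<le> 1"
    using graph_dist_triangle[of x z y] graph_dist_triangle[of y z x]
      graph_dist_adj[OF assms(2)] graph_dist_adj[OF adj_sym[OF assms(2)]] by simp
  then show ?thesis
    using adj_radius_diff[OF assms] unfolding kernel_def by linarith
qed

end

context doubling_graph begin

text \<open>On the ball of half the radius the kernel is at least half its height, and by doubling
  that ball carries a fixed fraction of the volume of \<open>B\<close>.\<close>

lemma kernel_mass_ge:
  assumes "finite B" "graph_ball \<mu> x (radius F x) \<subseteq> B"
    and "B \<subseteq> graph_ball \<mu> x (radius F x + 4)"
  shows "radius F x * volume \<mu> B \<le> 2 * D ^ 4 * (\<Sum>z\<in>B. kernel F x z * vertex_weight \<mu> z)"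
proof -
  let ?R = "radius F x"
  have R: "1 \<le> ?R" by (rule radius_ge_1)
  have "volume \<mu> B \<le> volume \<mu> (graph_ball \<mu> x (?R + 4))"
    by (intro volume_mono finite_graph_ball assms)
  \<comment> \<open>Four doublings of \<open>R / 2\<close> give \<open>8 * R\<close>, which is at
    least \<open>R + 4\<close> because \<open>R \<ge> 1\<close>.\<close>
  also have "\<dots> \<le> D ^ 4 * volume \<mu> (graph_ball \<mu> x (?R / 2))"
    using R by (intro volume_compare) auto
  finally have "?R * volume \<mu> B \<le> ?R * (D ^ 4 * volume \<mu> (graph_ball \<mu> x (?R / 2)))"
    using R by (intro mult_left_mono) auto
  also have "\<dots> = 2 * D ^ 4 * (\<Sum>z\<in>graph_ball \<mu> x (?R / 2). ?R / 2 * vertex_weight \<mu> z)"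
    by (simp add: volume_def sum_distrib_left mult_ac)
  also have "\<dots> \<le> 2 * D ^ 4 * (\<Sum>z\<in>graph_ball \<mu> x (?R / 2). kernel F x z * vertex_weight \<mu> z)"
    using D_ge_1 by (intro mult_left_mono sum_mono mult_right_mono)
      (auto simp: kernel_def mem_graph_ball)
  also have "\<dots> \<le> 2 * D ^ 4 * (\<Sum>z\<in>B. kernel F x z * vertex_weight \<mu> z)"
    using D_ge_1 R graph_ball_subset[of x x "?R / 2" ?R] assms(1,2)
    by (intro mult_left_mono sum_mono2) (auto simp: kernel_nonneg)
  finally show ?thesis .
qed

text \<open>Comparing with a nearest vertex of \<open>F\<close> shows that the gradient has
  \<open>q\<close>-mean of order \<open>s\<close> on a ball of radius about \<open>R\<close>.
  Poincare turns this into a mean oscillation of order \<open>R * s\<close>, and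
  \<open>kernel_average_diff\<close> together with the kernel mass cancels the factor
  \<open>R\<close>.\<close>

lemma smoothing_edge:
  fixes f :: "'a \<Rightarrow> 'k::{real_normed_field,banach}"
  assumes "1 \<le> q" "0 < P" "0 < s" and F: "F \<noteq> {}" "F \<inter> bad_set (grad \<mu> f) q s = {}"
    and poin: "\<And>x r. 0 < r \<Longrightarrow>
       (\<Sum>y\<in>graph_ball \<mu> x r. norm (f y - average \<mu> (graph_ball \<mu> x r) f) powr q * vertex_weight \<mu> y)
         \<le> P * r powr q * (\<Sum>y\<in>graph_ball \<mu> x r. grad \<mu> f y powr q * vertex_weight \<mu> y)"
    and xy: "adj \<mu> x y"
  shows "norm (smoothing F f y - smoothing F f x)
     \<le> 24 * D ^ 4 * (1 + 2 * D ^ 4) * (P * D\<^sup>2) powr (1 / q) * s"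
proof -
  let ?m = "vertex_weight \<mu>" and ?R = "radius F x"
  \<comment> \<open>Along an edge both centre and radius move by at most 1, so this ball contains
    the averaging balls of \<open>x\<close> and of \<open>y\<close>.\<close>
  define B where "B = graph_ball \<mu> x (?R + 2)"
  define V where "V = volume \<mu> B"
  define c where "c = average \<mu> B f"
  define S where "S = (\<Sum>z\<in>B. kernel F x z * ?m z)"
  define A where "A = (\<Sum>z\<in>B. norm (f z - c) * ?m z)"
  \<comment> \<open>The factor \<open>3 * R\<close> bounds the radius \<open>R + 2\<close> of
    \<open>B\<close>, and \<open>D\<^sup>2\<close> comes from recentring at a vertex of
    \<open>F\<close>.\<close>
  define \<epsilon> where "\<epsilon> = (P * D\<^sup>2) powr (1 / q) * (3 * ?R) * s"
  have R: "1 \<le> ?R" by (rule radius_ge_1)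
  have fin: "finite B" by (simp add: B_def finite_graph_ball)
  have V: "0 < V" unfolding V_def B_def using R by (intro volume_graph_ball_pos) simp
  have \<epsilon>: "0 < \<epsilon>" using assms(2,3) R D_ge_1 by (auto simp: \<epsilon>_def)
  have Bx: "graph_ball \<mu> x ?R \<subseteq> B" "B \<subseteq> graph_ball \<mu> x (?R + 4)"
    unfolding B_def by (intro graph_ball_subset, simp)+
  have "real (graph_dist \<mu> x y) \<le> 1" "real (graph_dist \<mu> y x) \<le> 1"
    using graph_dist_adj[OF xy] graph_dist_adj[OF adj_sym[OF xy]] by simp_all
  then have By: "graph_ball \<mu> y (radius F y) \<subseteq> B" "B \<subseteq> graph_ball \<mu> y (radius F y + 4)"
    using adj_radius_diff[OF F(1) xy] unfolding B_def by (intro graph_ball_subset, linarith)+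
  have Sx: "?R * V \<le> 2 * D ^ 4 * S"
    unfolding S_def V_def by (intro kernel_mass_ge fin Bx)
  have Sy: "radius F y * V \<le> 2 * D ^ 4 * (\<Sum>z\<in>B. kernel F y z * ?m z)"
    unfolding V_def by (intro kernel_mass_ge fin By)
  have "0 < ?R * V" using R V by simp
  with Sx have "0 < 2 * D ^ 4 * S" by linarith
  then have S: "0 < S" using D_ge_1 by (simp add: zero_less_mult_iff)
  \<comment> \<open>A nearest good vertex, at distance \<open>R - 1\<close>; as
    \<open>(R - 1) + (R + 2) = 2 * R + 1\<close>, the ball of that radius about it contains
    \<open>B\<close>.\<close>
  obtain x0 where x0: "x0 \<in> F" "graph_dist \<mu> x x0 = dist_to F x"
    using F(1) by (rule dist_to_attained)
  have dx0: "real (graph_dist \<mu> x x0) = ?R - 1"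
    using x0(2) by (simp add: radius_def)
  have "(\<Sum>z\<in>B. grad \<mu> f z powr q * ?m z)
      \<le> (\<Sum>z\<in>graph_ball \<mu> x0 (2 * ?R + 1). grad \<mu> f z powr q * ?m z)"
    unfolding B_def using dx0 graph_dist_sym[of x x0]
    by (intro sum_mono2 finite_graph_ball graph_ball_subset) auto
  also have "\<dots> \<le> s powr q * volume \<mu> (graph_ball \<mu> x0 (2 * ?R + 1))"
    using x0(1) F(2) R by (intro not_bad_setD) auto
  \<comment> \<open>Back to the centre \<open>x\<close>:
    \<open>(R - 1) + (2 * R + 1) = 3 * R\<close> is at most \<open>2\<^sup>2 * R\<close>.\<close>
  also have "\<dots> \<le> s powr q * (D\<^sup>2 * volume \<mu> (graph_ball \<mu> x ?R))"
    using R dx0 by (intro mult_left_mono volume_compare) auto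
  also have "\<dots> \<le> s powr q * (D\<^sup>2 * V)"
    unfolding V_def using D_ge_1 by (intro mult_left_mono volume_mono fin Bx) auto
  finally have g: "(\<Sum>z\<in>B. grad \<mu> f z powr q * ?m z) \<le> s powr q * (D\<^sup>2 * V)" .
  have "(\<Sum>z\<in>B. norm (f z - c) powr q * ?m z)
      \<le> P * (?R + 2) powr q * (\<Sum>z\<in>B. grad \<mu> f z powr q * ?m z)"
    unfolding B_def c_def using R by (intro poin) simp
  also have "\<dots> \<le> P * (3 * ?R) powr q * (s powr q * (D\<^sup>2 * V))"
    using assms(1,2) R by (intro mult_mono g mult_left_mono powr_mono2 sum_nonneg) auto
  also have "\<dots> = \<epsilon> powr q * V"
    using assms(1,2,3) R D_ge_1
    by (simp add: \<epsilon>_def powr_mult powr_powr)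
  finally have A: "A \<le> 2 * \<epsilon> * V"
    unfolding A_def V_def volume_def
    by (intro weighted_sum_le_of_power_sum_le[OF assms(1) \<epsilon>]) auto
  have "S * norm (smoothing F f x - smoothing F f y)
      \<le> 2 * (1 + 1 / (1 / (2 * D ^ 4))) * A"
    unfolding smoothing_superset[OF Bx(1) fin] smoothing_superset[OF By(1) fin] A_def S_def
  proof (rule kernel_average_diff[where R = "radius F y"])
    show "1 / (2 * D ^ 4) * radius F y * (\<Sum>z\<in>B. ?m z) \<le> (\<Sum>z\<in>B. kernel F y z * ?m z)"
      using Sy D_ge_1 by (simp add: V_def volume_def field_simps)
    show "\<bar>kernel F x z - kernel F y z\<bar> \<le> 2" for z
      by (rule adj_kernel_diff[OF F(1) xy])
  qed (use V S D_ge_1 radius_ge_1[of F y] in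
        \<open>auto simp: V_def S_def volume_def kernel_nonneg kernel_le_radius\<close>)
  also have "\<dots> = 2 * (1 + 2 * D ^ 4) * A"
    by simp
  also have "\<dots> \<le> 2 * (1 + 2 * D ^ 4) * (2 * \<epsilon> * V)"
    using A D_ge_1 by (intro mult_left_mono) auto
  finally have le: "S * norm (smoothing F f x - smoothing F f y)
      \<le> 2 * (1 + 2 * D ^ 4) * (2 * \<epsilon> * V)" .
  have "?R * V * norm (smoothing F f x - smoothing F f y)
      \<le> 2 * D ^ 4 * S * norm (smoothing F f x - smoothing F f y)"
    using Sx by (intro mult_right_mono) auto
  also have "\<dots> = 2 * D ^ 4 * (S * norm (smoothing F f x - smoothing F f y))"
    by (simp only: mult.assoc)
  also have "\<dots> \<le> 2 * D ^ 4 * (2 * (1 + 2 * D ^ 4) * (2 * \<epsilon> * V))"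
    using D_ge_1 by (intro mult_left_mono le) auto
  also have "\<dots> = (?R * V) * (24 * D ^ 4 * (1 + 2 * D ^ 4) * (P * D\<^sup>2) powr (1 / q) * s)"
    by (simp add: \<epsilon>_def algebra_simps)
  finally have "(?R * V) * norm (smoothing F f x - smoothing F f y)
      \<le> (?R * V) * (24 * D ^ 4 * (1 + 2 * D ^ 4) * (P * D\<^sup>2) powr (1 / q) * s)" .
  then show ?thesis
    using R V by (simp add: norm_minus_commute)
qed

end

section \<open>Calderon-Zygmund decomposition\<close>

lemma powr_add_le:
  fixes a b q :: real
  assumes "0 \<le> a" "0 \<le> b" "0 \<le> q"
  shows "(a + b) powr q \<le> 2 powr q * (a powr q + b powr q)"
proof -
  have "(a + b) powr q \<le> (2 * max a b) powr q"
    using assms by (intro powr_mono2) auto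
  also have "\<dots> = 2 powr q * max a b powr q"
    using assms by (simp add: powr_mult)
  also have "\<dots> \<le> 2 powr q * (a powr q + b powr q)"
    by (intro mult_left_mono) (auto simp: max_def)
  finally show ?thesis .
qed

section \<open>Explicit constants and the decomposition at one level\<close>

context doubling_graph begin

definition cz_slope :: "real \<Rightarrow> real \<Rightarrow> real" where
  "cz_slope P q = 24 * D ^ 4 * (1 + 2 * D ^ 4) * (P * D\<^sup>2) powr (1 / q)"

definition cz_const :: "real \<Rightarrow> real \<Rightarrow> real" where
  "cz_const P q = 2 powr q * (1 + (1 + cz_slope P q powr q) * (2 * D ^ 3))"

lemma cz_slope_nonneg: "0 \<le> cz_slope P q"
  using D_ge_1 by (simp add: cz_slope_def)

lemma cz_const_nonneg: "0 \<le> cz_const P q"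
  using D_ge_1 by (simp add: cz_const_def)

text \<open>The summand 1 makes the constant positive and the inequality of
  \<open>K_functional_lt\<close> strict; \<open>K_integrand_le\<close> draws its contradiction from
  that strictness.\<close>

definition interp_const :: "real \<Rightarrow> real \<Rightarrow> real" where
  "interp_const P q = cz_const P q powr (1 / q) + cz_slope P q + 1"

lemma interp_const_pos: "0 < interp_const P q"
  unfolding interp_const_def
  using cz_slope_nonneg[of P q] by (intro add_nonneg_pos add_nonneg_nonneg) auto

text \<open>Subtracting the smoothing from \<open>f\<close> leaves a function that vanishes off
  \<Omega>. Its gradient lives on the 1-neighbourhood of \<Omega>, is at most that of
  \<open>f\<close> plus a multiple of \<open>s\<close>, and is summed using the weak type
  bound.\<close>

lemma calderon_zygmund:
  fixes f :: "'a \<Rightarrow> 'k::{real_normed_field,banach}"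
  assumes "1 \<le> q" "0 < P" "0 < s"
    and poin: "\<And>x r. 0 < r \<Longrightarrow>
       (\<Sum>y\<in>graph_ball \<mu> x r. norm (f y - average \<mu> (graph_ball \<mu> x r) f) powr q * vertex_weight \<mu> y)
         \<le> P * r powr q * (\<Sum>y\<in>graph_ball \<mu> x r. grad \<mu> f y powr q * vertex_weight \<mu> y)"
    and H: "\<And>A. finite A \<Longrightarrow>
       (\<Sum>y\<in>{y\<in>A. s / 2 < grad \<mu> f y}. grad \<mu> f y powr q * vertex_weight \<mu> y) \<le> H"
  shows "\<exists>b. (\<forall>A. finite A \<longrightarrow> (\<Sum>x\<in>A. grad \<mu> b x powr q * vertex_weight \<mu> x) \<le> cz_const P q * H)
           \<and> (\<forall>x. grad \<mu> (\<lambda>x. f x - b x) x \<le> cz_slope P q * s)"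
proof -
  let ?m = "vertex_weight \<mu>" and ?g = "grad \<mu> f"
  define L where "L = cz_slope P q"
  define \<Omega> where "\<Omega> = bad_set ?g q s"
  define N where "N = (\<Union>y\<in>\<Omega>. graph_ball \<mu> y 1)"
  have L: "0 \<le> L" unfolding L_def by (rule cz_slope_nonneg)
  obtain b :: "'a \<Rightarrow> 'k" where b: "\<And>x. grad \<mu> (\<lambda>x. f x - b x) x \<le> L * s"
      "\<And>x. x \<notin> N \<Longrightarrow> grad \<mu> b x = 0"
  \<comment> \<open>Smoothing needs a nonempty good set. If every vertex is bad, \<open>f\<close>
    itself is taken as \<open>b\<close> and the remainder is zero.\<close>
  proof (cases "\<Omega> = UNIV")
    case True
    have "x \<in> N" for x
      using True by (auto simp: N_def mem_graph_ball intro!: exI[of _ x])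
    moreover have "grad \<mu> (\<lambda>x. f x - f x) x \<le> L * s" for x
      using L assms(3) by (simp add: grad_def)
    ultimately show ?thesis using that[of f] by blast
  next
    case False
    let ?b = "\<lambda>x. f x - smoothing (- \<Omega>) f x"
    have "norm (smoothing (- \<Omega>) f y - smoothing (- \<Omega>) f x) \<le> L * s" if "adj \<mu> x y" for x y
      unfolding L_def cz_slope_def using False poin that
      by (intro smoothing_edge assms) (auto simp: \<Omega>_def)
    then have "grad \<mu> (smoothing (- \<Omega>) f) x \<le> L * s" for x
      using L assms(3) by (intro grad_le_of_edges) auto
    \<comment> \<open>The gradient at \<open>x\<close> sees only vertices within distance 1, and off
      \<open>N\<close> none of them is bad.\<close>
    moreover have "grad \<mu> ?b x = 0" if x: "x \<notin> N" for x
    proof -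
      have "y \<notin> \<Omega>" if "graph_dist \<mu> y x \<le> 1" for y
        using x that by (auto simp: N_def mem_graph_ball)
      then have "?b y = 0" if "graph_dist \<mu> y x \<le> 1" for y
        using that by (simp add: smoothing_eq)
      then have "grad \<mu> ?b x \<le> 0"
        using graph_dist_adj[OF adj_sym] by (intro grad_le_of_edges) auto
      then show ?thesis using grad_nonneg[of ?b x] by linarith
    qed
    ultimately show ?thesis using that[of ?b] by simp
  qed
  have bg: "grad \<mu> b x \<le> ?g x + L * s" for x
  proof -
    have "grad \<mu> (\<lambda>x. f x + - (f x - b x)) x \<le> ?g x + grad \<mu> (\<lambda>x. - (f x - b x)) x"
      by (rule grad_add_le)
    then show ?thesis
      using b(1)[of x] by (simp only: grad_uminus) simp
  qed
  have "(\<Sum>x\<in>A. grad \<mu> b x powr q * ?m x) \<le> cz_const P q * H" if A: "finite A" for A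
  proof -
    define A1 where "A1 = A \<inter> N"
    have fin: "finite A1" using A by (simp add: A1_def)
    \<comment> \<open>The weak type bound concerns finite subsets of \<Omega>, so each point of
      \<open>A1\<close> is assigned a bad vertex within distance 1.\<close>
    obtain c where c: "\<And>x. x \<in> A1 \<Longrightarrow> c x \<in> \<Omega> \<and> x \<in> graph_ball \<mu> (c x) 1"
      unfolding A1_def N_def by (metis IntD2 UN_E)
    have "volume \<mu> A1 \<le> volume \<mu> (\<Union>y\<in>c ` A1. graph_ball \<mu> y 1)"
      using c fin by (intro volume_mono) (auto simp: finite_graph_ball)
    also have "\<dots> \<le> (\<Sum>y\<in>c ` A1. volume \<mu> (graph_ball \<mu> y 1))"
      using fin by (intro volume_UN_le finite_graph_ball) simp
    also have "\<dots> \<le> (\<Sum>y\<in>c ` A1. D * ?m y)"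
    proof (intro sum_mono)
      fix y
      \<comment> \<open>Doubling from radius 1/2, where the ball is just \<open>{y}\<close>.\<close>
      show "volume \<mu> (graph_ball \<mu> y 1) \<le> D * ?m y"
        using volume_doubling[of "1 / 2" y] graph_ball_small[of "1 / 2" y]
        by (simp add: volume_def)
    qed
    also have "\<dots> = D * volume \<mu> (c ` A1)"
      by (simp add: volume_def sum_distrib_left)
    finally have "s powr q * volume \<mu> A1 \<le> s powr q * (D * volume \<mu> (c ` A1))"
      by (intro mult_left_mono) auto
    also have "\<dots> = D * (s powr q * volume \<mu> (c ` A1))" by simp
    also have "\<dots> \<le> D * (2 * D\<^sup>2 * H)"
      using D_ge_1 assms(1,3) fin c H
      by (intro mult_left_mono volume_bad_set_le[where g = ?g]) (auto simp: \<Omega>_def)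
    finally have vol: "s powr q * volume \<mu> A1 \<le> 2 * D ^ 3 * H"
      by (simp add: power2_eq_square power3_eq_cube mult_ac)
    \<comment> \<open>The part below \<open>s / 2\<close> is paid for by the volume of
      \<open>A1\<close>, leaving the part counted by \<open>H\<close>.\<close>
    have "?g x powr q \<le> (if s / 2 < ?g x then ?g x powr q else 0) + s powr q / 2" for x
      using half_powr_le[of q "?g x" s] assms(1,3) by auto
    then have "(\<Sum>x\<in>A1. ?g x powr q * ?m x)
        \<le> (\<Sum>x\<in>A1. ((if s / 2 < ?g x then ?g x powr q else 0) + s powr q / 2) * ?m x)"
      by (intro sum_mono mult_right_mono) auto
    also have "\<dots> = (\<Sum>x\<in>A1. if s / 2 < ?g x then ?g x powr q * ?m x else 0)
        + s powr q / 2 * volume \<mu> A1"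
      by (simp add: distrib_right sum.distrib volume_def sum_distrib_left
          if_distrib[of "\<lambda>u. u * _"] cong: if_cong)
    also have "\<dots> = (\<Sum>x\<in>{x\<in>A1. s / 2 < ?g x}. ?g x powr q * ?m x) + s powr q / 2 * volume \<mu> A1"
      using fin by (simp add: sum.inter_filter)
    also have "\<dots> \<le> H + s powr q * volume \<mu> A1"
      by (intro add_mono H fin) simp
    finally have g: "(\<Sum>x\<in>A1. ?g x powr q * ?m x) \<le> H + s powr q * volume \<mu> A1" .
    have "(\<Sum>x\<in>A. grad \<mu> b x powr q * ?m x) = (\<Sum>x\<in>A1. grad \<mu> b x powr q * ?m x)"
      using A by (intro sum.mono_neutral_right) (auto simp: A1_def b(2))
    also have "\<dots> \<le> (\<Sum>x\<in>A1. 2 powr q * (?g x powr q + (L * s) powr q) * ?m x)"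
    proof (intro sum_mono mult_right_mono)
      fix x
      have "grad \<mu> b x powr q \<le> (?g x + L * s) powr q"
        using assms(1) by (intro powr_mono2 bg) auto
      also have "\<dots> \<le> 2 powr q * (?g x powr q + (L * s) powr q)"
        using assms(1,3) L by (intro powr_add_le) auto
      finally show "grad \<mu> b x powr q \<le> 2 powr q * (?g x powr q + (L * s) powr q)" .
    qed simp
    also have "\<dots> = 2 powr q * ((\<Sum>x\<in>A1. ?g x powr q * ?m x) + L powr q * (s powr q * volume \<mu> A1))"
      using L assms(3)
      by (simp add: powr_mult distrib_left distrib_right sum.distrib sum_distrib_left volume_def mult_ac)
    also have "\<dots> \<le> 2 powr q * (H + (1 + L powr q) * (s powr q * volume \<mu> A1))"
      using g by (simp add: distrib_right)
    also have "\<dots> \<le> 2 powr q * (H + (1 + L powr q) * (2 * D ^ 3 * H))"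
      by (intro mult_left_mono add_left_mono vol) auto
    also have "\<dots> = cz_const P q * H"
      by (simp add: cz_const_def L_def algebra_simps)
    finally show ?thesis .
  qed
  then show ?thesis
    using b(1) unfolding L_def by blast
qed

end

section \<open>The K-functional and the Sobolev spaces\<close>

lemma nn_integral_powr_0:
  fixes e c :: real
  assumes "0 < e" "0 \<le> c"
  shows "(\<integral>\<^sup>+t\<in>{0<..c}. ennreal (t powr (e - 1)) \<partial>lborel) = ennreal (c powr e / e)"
proof -
  have "(\<integral>\<^sup>+t\<in>{0..c}. ennreal (t powr (e - 1)) \<partial>lborel) = ennreal (c powr e / e)"
    using nn_integral_has_integral_lebesgue[OF _ has_integral_powr_from_0[of "e - 1" c]] assms
    by (simp add: ennreal_mult' ennreal_indicator mult.commute)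
  \<comment> \<open>At the endpoint both sides are 0, since \<open>0 powr a = 0\<close> for every
    exponent.\<close>
  moreover have "ennreal (t powr (e - 1)) * indicator {0..c} t = ennreal (t powr (e - 1)) * indicator {0<..c} t"
    for t by (cases "t = 0") (auto simp: indicator_def)
  ultimately show ?thesis by simp
qed

lemma nn_integral_powr_inf:
  fixes e c :: real
  assumes "0 < e" "0 < c"
  shows "(\<integral>\<^sup>+t\<in>{c..}. ennreal (t powr (- e - 1)) \<partial>lborel) = ennreal (c powr (- e) / e)"
  using nn_integral_has_integral_lebesgue[OF _ has_integral_powr_to_inf[of "- e - 1" c]] assms
  by (simp add: ennreal_mult' ennreal_indicator mult.commute)

lemma K_integrand_eq:
  fixes t k p q :: real
  assumes "0 < t" "0 \<le> k" "0 < p"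
  shows "(t powr - (1 - q / p) * k) powr p / t = k powr p * t powr (q - p - 1)"
proof -
  have "(t powr - (1 - q / p) * k) powr p / t = k powr p * (t powr (- (1 - q / p) * p) / t powr 1)"
    using assms by (simp add: powr_mult powr_powr)
  also have "t powr (- (1 - q / p) * p) / t powr 1 = t powr (- (1 - q / p) * p - 1)"
    by (rule powr_diff[symmetric])
  also have "- (1 - q / p) * p - 1 = q - p - 1"
    using assms by (simp add: field_simps)
  finally show ?thesis .
qed

section \<open>The K-functional of a couple\<close>

locale normed_couple =
  fixes A\<^sub>0 A\<^sub>1 :: "'v::real_vector normed_subspace"
  assumes norm_nonneg_0: "a \<in> elems A\<^sub>0 \<Longrightarrow> 0 \<le> norm_on A\<^sub>0 a"
    and norm_nonneg_1: "a \<in> elems A\<^sub>1 \<Longrightarrow> 0 \<le> norm_on A\<^sub>1 a"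
begin

lemma K_functional_le:
  assumes "a\<^sub>0 \<in> elems A\<^sub>0" "a\<^sub>1 \<in> elems A\<^sub>1" "f = a\<^sub>0 + a\<^sub>1" "0 \<le> t"
  shows "K_functional A\<^sub>0 A\<^sub>1 t f \<le> norm_on A\<^sub>0 a\<^sub>0 + t * norm_on A\<^sub>1 a\<^sub>1"
  unfolding K_functional_def using assms norm_nonneg_0 norm_nonneg_1
  by (intro cInf_lower bdd_belowI[of _ 0]) auto

text \<open>The existence of a decomposition makes the set under \<open>Inf\<close> nonempty, as a
  bound from below requires.\<close>

lemma K_functional_ge:
  assumes "\<exists>a\<^sub>0\<in>elems A\<^sub>0. \<exists>a\<^sub>1\<in>elems A\<^sub>1. f = a\<^sub>0 + a\<^sub>1"
    and "\<And>a\<^sub>0 a\<^sub>1. a\<^sub>0 \<in> elems A\<^sub>0 \<Longrightarrow> a\<^sub>1 \<in> elems A\<^sub>1 \<Longrightarrow> f = a\<^sub>0 + a\<^sub>1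
            \<Longrightarrow> c \<le> norm_on A\<^sub>0 a\<^sub>0 + t * norm_on A\<^sub>1 a\<^sub>1"
  shows "c \<le> K_functional A\<^sub>0 A\<^sub>1 t f"
  unfolding K_functional_def using assms by (intro cInf_greatest) blast+

lemma K_functional_approx:
  assumes "\<exists>a\<^sub>0\<in>elems A\<^sub>0. \<exists>a\<^sub>1\<in>elems A\<^sub>1. f = a\<^sub>0 + a\<^sub>1" "K_functional A\<^sub>0 A\<^sub>1 t f < c"
  obtains a\<^sub>0 a\<^sub>1 where "a\<^sub>0 \<in> elems A\<^sub>0" "a\<^sub>1 \<in> elems A\<^sub>1" "f = a\<^sub>0 + a\<^sub>1"
    "norm_on A\<^sub>0 a\<^sub>0 + t * norm_on A\<^sub>1 a\<^sub>1 < c"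
  using K_functional_ge[OF assms(1), of c t] assms(2) by (meson not_less)

context
  fixes f
  assumes decomp: "\<exists>a\<^sub>0\<in>elems A\<^sub>0. \<exists>a\<^sub>1\<in>elems A\<^sub>1. f = a\<^sub>0 + a\<^sub>1"
begin

lemma K_functional_nonneg: "0 \<le> t \<Longrightarrow> 0 \<le> K_functional A\<^sub>0 A\<^sub>1 t f"
  using norm_nonneg_0 norm_nonneg_1 by (intro K_functional_ge[OF decomp]) auto

lemma K_functional_mono:
  assumes "0 \<le> s" "s \<le> t"
  shows "K_functional A\<^sub>0 A\<^sub>1 s f \<le> K_functional A\<^sub>0 A\<^sub>1 t f"
proof (rule K_functional_ge[OF decomp])
  fix a\<^sub>0 a\<^sub>1 assume a: "a\<^sub>0 \<in> elems A\<^sub>0" "a\<^sub>1 \<in> elems A\<^sub>1" "f = a\<^sub>0 + a\<^sub>1"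
  have "K_functional A\<^sub>0 A\<^sub>1 s f \<le> norm_on A\<^sub>0 a\<^sub>0 + s * norm_on A\<^sub>1 a\<^sub>1"
    using K_functional_le[OF a assms(1)] .
  also have "\<dots> \<le> norm_on A\<^sub>0 a\<^sub>0 + t * norm_on A\<^sub>1 a\<^sub>1"
    using assms a norm_nonneg_1 by (intro add_left_mono mult_right_mono) auto
  finally show "K_functional A\<^sub>0 A\<^sub>1 s f \<le> norm_on A\<^sub>0 a\<^sub>0 + t * norm_on A\<^sub>1 a\<^sub>1" .
qed

text \<open>\<open>K t / t\<close> is an infimum of expressions of the form norm of the first part
  over \<open>t\<close> plus norm of the second part, each nonincreasing in
  \<open>t\<close>.\<close>

lemma K_functional_slope_antimono:
  assumes "0 < s" "s \<le> t"
  shows "K_functional A\<^sub>0 A\<^sub>1 t f / t \<le> K_functional A\<^sub>0 A\<^sub>1 s f / s"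
proof -
  have "s / t * K_functional A\<^sub>0 A\<^sub>1 t f \<le> K_functional A\<^sub>0 A\<^sub>1 s f"
  proof (rule K_functional_ge[OF decomp])
    fix a\<^sub>0 a\<^sub>1 assume a: "a\<^sub>0 \<in> elems A\<^sub>0" "a\<^sub>1 \<in> elems A\<^sub>1" "f = a\<^sub>0 + a\<^sub>1"
    have "s / t * K_functional A\<^sub>0 A\<^sub>1 t f \<le> s / t * (norm_on A\<^sub>0 a\<^sub>0 + t * norm_on A\<^sub>1 a\<^sub>1)"
      using assms K_functional_le[OF a, of t] by (intro mult_left_mono) auto
    also have "\<dots> = s / t * norm_on A\<^sub>0 a\<^sub>0 + s * norm_on A\<^sub>1 a\<^sub>1"
      using assms by (simp add: field_simps)
    also have "\<dots> \<le> 1 * norm_on A\<^sub>0 a\<^sub>0 + s * norm_on A\<^sub>1 a\<^sub>1"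
      using assms a norm_nonneg_0 by (intro add_right_mono mult_right_mono) auto
    finally show "s / t * K_functional A\<^sub>0 A\<^sub>1 t f \<le> norm_on A\<^sub>0 a\<^sub>0 + s * norm_on A\<^sub>1 a\<^sub>1" by simp
  qed
  then show ?thesis using assms by (simp add: field_simps)
qed

end

end

section \<open>Lebesgue norms through finite sums, and the couple of Sobolev spaces\<close>

context weighted_graph begin

lemma Lp_space_bounded_sums:
  assumes "0 < p" "\<And>A. finite A \<Longrightarrow> (\<Sum>x\<in>A. \<bar>g x\<bar> powr p * vertex_weight \<mu> x) \<le> c"
  shows "g \<in> Lp_space \<mu> (ereal p)" and "Lp_norm \<mu> (ereal p) g \<le> c powr (1 / p)"
proof -
  have summable: "(\<lambda>x. \<bar>g x\<bar> powr p * vertex_weight \<mu> x) summable_on UNIV"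
    using assms(2) by (intro nonneg_bdd_above_summable_on bdd_aboveI[of _ c]) auto
  then show "g \<in> Lp_space \<mu> (ereal p)"
    by (simp add: Lp_space_def)
  have "(\<Sum>\<^sub>\<infinity>x. \<bar>g x\<bar> powr p * vertex_weight \<mu> x) \<le> c"
    using assms(2) by (intro infsum_le_finite_sums[OF summable]) auto
  then show "Lp_norm \<mu> (ereal p) g \<le> c powr (1 / p)"
    using assms(1) by (auto simp: Lp_norm_def intro!: powr_mono2 infsum_nonneg)
qed

lemma sum_le_Lp_norm:
  assumes "0 < p" "g \<in> Lp_space \<mu> (ereal p)" "finite A"
  shows "(\<Sum>x\<in>A. \<bar>g x\<bar> powr p * vertex_weight \<mu> x) \<le> Lp_norm \<mu> (ereal p) g powr p"
proof -
  have "(\<Sum>x\<in>A. \<bar>g x\<bar> powr p * vertex_weight \<mu> x) \<le> (\<Sum>\<^sub>\<infinity>x. \<bar>g x\<bar> powr p * vertex_weight \<mu> x)"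
    using assms by (intro finite_sum_le_infsum) (auto simp: Lp_space_def)
  also have "\<dots> = Lp_norm \<mu> (ereal p) g powr p"
    using assms(1) by (simp add: Lp_norm_def powr_powr infsum_nonneg)
  finally show ?thesis .
qed

lemma Linf_space_bounded:
  assumes "\<And>x. \<bar>g x\<bar> \<le> c"
  shows "g \<in> Lp_space \<mu> \<infinity>" and "Lp_norm \<mu> \<infinity> g \<le> c"
proof -
  show "g \<in> Lp_space \<mu> \<infinity>"
    using assms by (auto simp: Lp_space_def intro!: boundedI[of _ c])
  show "Lp_norm \<mu> \<infinity> g \<le> c"
    using assms by (auto simp: Lp_norm_def intro: cSUP_least)
qed

lemma le_Linf_norm:
  assumes "g \<in> Lp_space \<mu> \<infinity>"
  shows "\<bar>g x\<bar> \<le> Lp_norm \<mu> \<infinity> g"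
proof -
  obtain c where "\<And>x. \<bar>g x\<bar> \<le> c"
    using assms by (auto simp: Lp_space_def bounded_iff)
  then have "bdd_above (range (\<lambda>x. \<bar>g x\<bar>))"
    by (intro bdd_aboveI[of _ c]) auto
  then show ?thesis
    by (auto simp: Lp_norm_def intro: cSUP_upper)
qed

lemma grad_mod_const_eq [simp]: "grad_mod_const \<mu> (mod_const f) = grad \<mu> f"
  by (rule grad_mod_const.abs_eq)

lemma mod_const_exhaust: obtains f where "F = mod_const f"
  by (metis Quotient_abs_rep Quotient_fun_mod_const)

lemma grad_mod_const_nonneg [simp]: "0 \<le> grad_mod_const \<mu> F x"
  by (cases F rule: mod_const_exhaust) simp

lemma grad_mod_const_add_le:
  "grad_mod_const \<mu> (F + G) x \<le> grad_mod_const \<mu> F x + grad_mod_const \<mu> G x"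
  by (cases F rule: mod_const_exhaust, cases G rule: mod_const_exhaust)
    (simp add: plus_fun_mod_const.abs_eq grad_add_le)

lemma mem_W_dot: "F \<in> elems (W_dot \<mu> p) \<longleftrightarrow> grad_mod_const \<mu> F \<in> Lp_space \<mu> p"
proof
  assume "grad_mod_const \<mu> F \<in> Lp_space \<mu> p"
  moreover obtain f where "F = mod_const f"
    by (rule mod_const_exhaust)
  ultimately show "F \<in> elems (W_dot \<mu> p)"
    by (auto simp: W_dot_def E_dot_def)
qed (auto simp: W_dot_def E_dot_def)

lemma norm_on_W_dot: "norm_on (W_dot \<mu> p) F = Lp_norm \<mu> p (grad_mod_const \<mu> F)"
  by (simp add: W_dot_def)

lemma normed_couple_W_dot: "normed_couple (W_dot \<mu> (ereal q)) (W_dot \<mu> \<infinity>)"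
proof
  fix F :: "('a, 'b::{real_normed_field,banach}) fun_mod_const"
  show "0 \<le> norm_on (W_dot \<mu> (ereal q)) F"
    by (simp add: norm_on_W_dot Lp_norm_def)
  assume "F \<in> elems (W_dot \<mu> \<infinity>)"
  then show "0 \<le> norm_on (W_dot \<mu> \<infinity>) F"
    \<comment> \<open>Any vertex, here \<open>undefined\<close>, bounds the supremum from below by
      0.\<close>
    using order_trans[OF abs_ge_zero le_Linf_norm[of "grad_mod_const \<mu> F" undefined]]
    by (simp add: mem_W_dot norm_on_W_dot)
qed

end

section \<open>From interpolation spaces to Sobolev spaces\<close>

context weighted_graph begin

context
  fixes q p :: real and F :: "('a, 'k::{real_normed_field,banach}) fun_mod_const"
  assumes q: "1 \<le> q" and qp: "q < p"
    and decomp: "\<exists>a\<^sub>0\<in>elems (W_dot \<mu> (ereal q)). \<exists>a\<^sub>1\<in>elems (W_dot \<mu> \<infinity>). F = a\<^sub>0 + a\<^sub>1"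
begin

interpretation W: normed_couple
  "W_dot \<mu> (ereal q) :: ('a, 'k) fun_mod_const normed_subspace" "W_dot \<mu> \<infinity>"
  by (rule normed_couple_W_dot)

private abbreviation K :: "real \<Rightarrow> real" where
  "K t \<equiv> K_functional (W_dot \<mu> (ereal q)) (W_dot \<mu> \<infinity>) t F"

private abbreviation g :: "'a \<Rightarrow> real" where
  "g \<equiv> grad_mod_const \<mu> F"

text \<open>One vertex of weight at least \<open>t powr q\<close> already forces the
  \<open>L\<^sup>q\<close> norm of a function to be at least \<open>t\<close> times its value there.
  This shows in \<open>K_crosses_level\<close> that the slope exceeds \<open>g x / 4\<close> for
  some \<open>t\<close>.\<close>

lemma grad_le_K:
  assumes "0 < t" "t powr q \<le> vertex_weight \<mu> x"
  shows "g x \<le> K t / t"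
proof -
  have "t * g x \<le> K t"
  proof (rule W.K_functional_ge[OF decomp])
    fix a\<^sub>0 a\<^sub>1 :: "('a, 'k) fun_mod_const"
    assume a: "a\<^sub>0 \<in> elems (W_dot \<mu> (ereal q))" "a\<^sub>1 \<in> elems (W_dot \<mu> \<infinity>)" "F = a\<^sub>0 + a\<^sub>1"
    let ?n = "norm_on (W_dot \<mu> (ereal q)) a\<^sub>0"
    have n: "0 \<le> ?n" using W.norm_nonneg_0[OF a(1)] .
    have "(t * grad_mod_const \<mu> a\<^sub>0 x) powr q = grad_mod_const \<mu> a\<^sub>0 x powr q * t powr q"
      using assms(1) by (simp add: powr_mult)
    also have "\<dots> \<le> grad_mod_const \<mu> a\<^sub>0 x powr q * vertex_weight \<mu> x"
      by (intro mult_left_mono assms) simp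
    also have "\<dots> \<le> ?n powr q"
      using sum_le_Lp_norm[of q "grad_mod_const \<mu> a\<^sub>0" "{x}"] q a(1)
      by (simp add: mem_W_dot norm_on_W_dot)
    finally have "t * grad_mod_const \<mu> a\<^sub>0 x \<le> ?n"
      using q n powr_less_mono2[of q ?n "t * grad_mod_const \<mu> a\<^sub>0 x"] by force
    moreover have "t * grad_mod_const \<mu> a\<^sub>1 x \<le> t * norm_on (W_dot \<mu> \<infinity>) a\<^sub>1"
      using le_Linf_norm[of "grad_mod_const \<mu> a\<^sub>1" x] a(2) assms(1)
      by (intro mult_left_mono) (auto simp: mem_W_dot norm_on_W_dot)
    moreover have "t * g x \<le> t * (grad_mod_const \<mu> a\<^sub>0 x + grad_mod_const \<mu> a\<^sub>1 x)"
      using assms(1) a(3) by (intro mult_left_mono) (auto simp: grad_mod_const_add_le)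
    ultimately show "t * g x \<le> ?n + t * norm_on (W_dot \<mu> \<infinity>) a\<^sub>1"
      by (simp add: distrib_left)
  qed
  then show ?thesis using assms(1) by (simp add: field_simps)
qed

text \<open>A near-optimal decomposition has an \<open>L\<^sup>\<infinity>\<close> part below \<open>g / 2\<close> wherever \<open>g\<close> exceeds
  \<open>4 K t / t\<close>, so there the \<open>L\<^sup>q\<close> part carries at least half of \<open>g\<close>.\<close>

lemma sum_large_grad_le_K:
  assumes "0 < t" "finite A" "\<And>x. x \<in> A \<Longrightarrow> 4 * (K t / t) \<le> g x" "0 < K t"
  shows "(\<Sum>x\<in>A. g x powr q * vertex_weight \<mu> x) \<le> (4 * K t) powr q"
proof -
  have "K t < 2 * K t" using assms by simp
  then obtain a\<^sub>0 a\<^sub>1 :: "('a, 'k) fun_mod_const"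
    where a: "a\<^sub>0 \<in> elems (W_dot \<mu> (ereal q))" "a\<^sub>1 \<in> elems (W_dot \<mu> \<infinity>)" "F = a\<^sub>0 + a\<^sub>1"
    and le: "norm_on (W_dot \<mu> (ereal q)) a\<^sub>0 + t * norm_on (W_dot \<mu> \<infinity>) a\<^sub>1 < 2 * K t"
    using W.K_functional_approx[OF decomp] by metis
  note n = W.norm_nonneg_0[OF a(1)] W.norm_nonneg_1[OF a(2)]
  have "t * norm_on (W_dot \<mu> \<infinity>) a\<^sub>1 \<le> 2 * K t" using le n by simp
  then have n1: "norm_on (W_dot \<mu> \<infinity>) a\<^sub>1 \<le> 2 * (K t / t)"
    using assms(1) by (simp add: field_simps)
  have "0 \<le> t * norm_on (W_dot \<mu> \<infinity>) a\<^sub>1" using n assms(1) by simp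
  then have n0: "norm_on (W_dot \<mu> (ereal q)) a\<^sub>0 \<le> 2 * K t" using le by linarith
  have "g x \<le> 2 * grad_mod_const \<mu> a\<^sub>0 x" if "x \<in> A" for x
    using grad_mod_const_add_le[of a\<^sub>0 a\<^sub>1 x] a(2,3) n1 assms(3)[OF that]
      le_Linf_norm[of "grad_mod_const \<mu> a\<^sub>1" x]
    by (simp add: mem_W_dot norm_on_W_dot)
  then have "(\<Sum>x\<in>A. g x powr q * vertex_weight \<mu> x)
      \<le> (\<Sum>x\<in>A. (2 * grad_mod_const \<mu> a\<^sub>0 x) powr q * vertex_weight \<mu> x)"
    using q by (intro sum_mono mult_right_mono powr_mono2) auto
  also have "\<dots> = 2 powr q * (\<Sum>x\<in>A. \<bar>grad_mod_const \<mu> a\<^sub>0 x\<bar> powr q * vertex_weight \<mu> x)"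
    by (simp add: powr_mult sum_distrib_left mult.assoc)
  also have "\<dots> \<le> 2 powr q * norm_on (W_dot \<mu> (ereal q)) a\<^sub>0 powr q"
    using sum_le_Lp_norm[of q "grad_mod_const \<mu> a\<^sub>0" A] q a(1) assms(2)
    by (intro mult_left_mono) (auto simp: mem_W_dot norm_on_W_dot)
  also have "\<dots> \<le> 2 powr q * (2 * K t) powr q"
    using n n0 q by (intro mult_left_mono powr_mono2) auto
  also have "\<dots> = (4 * K t) powr q"
    using assms(4) by (simp flip: powr_mult)
  finally show ?thesis .
qed

text \<open>Locates, up to a factor 2, the time at which the nonincreasing slope
  \<open>K t / t\<close> falls to \<open>g x / 4\<close>; the factor 2 dispenses with the behaviour
  at the crossing time itself.\<close>

lemma K_crosses_level:
  assumes fin: "K_integral (W_dot \<mu> (ereal q)) (W_dot \<mu> \<infinity>) (1 - q / p) p F < \<infinity>"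
    and gx: "0 < g x"
  obtains T where "0 < T" "g x / 4 < K T / T" "\<And>t. 2 * T \<le> t \<Longrightarrow> K t / t \<le> g x / 4"
proof -
  define U where "U = {t. 0 < t \<and> g x / 4 < K t / t}"
  define \<kappa> where "\<kappa> = enn2real (K_integral (W_dot \<mu> (ereal q)) (W_dot \<mu> \<infinity>) (1 - q / p) p F)"
  have \<kappa>: "K_integral (W_dot \<mu> (ereal q)) (W_dot \<mu> \<infinity>) (1 - q / p) p F = ennreal \<kappa>" "0 \<le> \<kappa>"
    using fin by (simp_all add: \<kappa>_def)
  have u: "vertex_weight \<mu> x powr (1 / q) \<in> U"
  proof -
    have "g x \<le> K (vertex_weight \<mu> x powr (1 / q)) / vertex_weight \<mu> x powr (1 / q)"
      using q vertex_weight_pos[of x] by (intro grad_le_K) (auto simp: powr_powr)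
    moreover have "g x / 4 < g x" using gx by simp
    ultimately have "g x / 4 < K (vertex_weight \<mu> x powr (1 / q)) / vertex_weight \<mu> x powr (1 / q)"
      by (rule order_less_le_trans[rotated])
    then show ?thesis using vertex_weight_pos[of x] by (simp add: U_def del: times_divide_eq_left)
  qed
  \<comment> \<open>On \<open>{0<..T}\<close> the slope stays above \<open>g x / 4\<close>, so the
    K-integral is at least \<open>(g x / 4) powr p * T powr q / q\<close>; its finiteness bounds
    \<open>T\<close>.\<close>
  have bdd: "T powr q \<le> q * \<kappa> / (g x / 4) powr p" if T: "T \<in> U" for T
  proof -
    have T0: "0 < T" using T by (simp add: U_def)
    have "ennreal ((g x / 4) powr p * (T powr q / q))
        = ennreal ((g x / 4) powr p) * (\<integral>\<^sup>+t\<in>{0<..T}. ennreal (t powr (q - 1)) \<partial>lborel)"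
      using q T0 by (subst nn_integral_powr_0) (auto simp: ennreal_mult simp del: times_divide_eq_right)
    also have "\<dots> = (\<integral>\<^sup>+t\<in>{0<..T}. ennreal ((g x / 4) powr p * t powr (q - 1)) \<partial>lborel)"
      by (subst nn_integral_cmult[symmetric]) (auto simp: ennreal_mult mult.assoc)
    also have "\<dots> \<le> K_integral (W_dot \<mu> (ereal q)) (W_dot \<mu> \<infinity>) (1 - q / p) p F"
      unfolding K_integral_def
    proof (intro nn_integral_mono)
      fix t :: real
      have "(g x / 4) powr p * t powr (q - 1) \<le> (t powr - (1 - q / p) * K t) powr p / t"
        if t: "0 < t" "t \<le> T"
      proof -
        have "g x / 4 \<le> K t / t"
          using W.K_functional_slope_antimono[OF decomp t] T unfolding U_def mem_Collect_eq
          by linarith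
        then have "g x / 4 * t \<le> K t"
          using t by (simp add: field_simps)
        then have "(t powr - (1 - q / p) * (g x / 4 * t)) powr p / t
            \<le> (t powr - (1 - q / p) * K t) powr p / t"
          using t q qp gx by (intro divide_right_mono powr_mono2 mult_left_mono) auto
        moreover have "(t powr - (1 - q / p) * (g x / 4 * t)) powr p / t
            = (g x / 4 * t) powr p * t powr (q - p - 1)"
          using t q qp by (intro K_integrand_eq) auto
        moreover have "(g x / 4 * t) powr p = (g x / 4) powr p * t powr p"
          by (rule powr_mult)
        moreover have "(g x / 4) powr p * t powr p * t powr (q - p - 1) = (g x / 4) powr p * t powr (q - 1)"
          unfolding mult.assoc powr_add[symmetric] by simp
        ultimately show ?thesis by (simp only:)
      qed
      then show "ennreal ((g x / 4) powr p * t powr (q - 1)) * indicator {0<..T} t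
          \<le> ennreal ((t powr - (1 - q / p) * K t) powr p / t) * indicator {0<..} t"
        by (auto simp: indicator_def intro!: ennreal_leI)
    qed
    finally have "(g x / 4) powr p * (T powr q / q) \<le> \<kappa>"
      using \<kappa> by simp
    then show ?thesis using q gx by (simp add: field_simps)
  qed
  have "bdd_above U"
  proof (intro bdd_aboveI)
    fix T assume T: "T \<in> U"
    then have "T = (T powr q) powr (1 / q)" using q by (simp add: powr_powr U_def)
    also have "\<dots> \<le> (q * \<kappa> / (g x / 4) powr p) powr (1 / q)"
      using q bdd[OF T] by (intro powr_mono2) auto
    finally show "T \<le> (q * \<kappa> / (g x / 4) powr p) powr (1 / q)" .
  qed
  then have "vertex_weight \<mu> x powr (1 / q) \<le> Sup U" using u by (intro cSup_upper)
  then have "0 < Sup U" using vertex_weight_pos[of x] by (smt (verit) powr_gt_zero)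
  \<comment> \<open>Choosing \<open>T\<close> in \<open>U\<close> beyond half the supremum puts
    every \<open>t \<ge> 2 * T\<close> outside \<open>U\<close>.\<close>
  then have "Sup U / 2 < Sup U" by simp
  then obtain T where T: "T \<in> U" "Sup U / 2 < T"
    using less_cSupD[of U "Sup U / 2"] u by blast
  show ?thesis
  proof
    show "0 < T" "g x / 4 < K T / T" using T by (auto simp: U_def)
    fix t assume "2 * T \<le> t"
    then have "t \<notin> U" using cSup_upper[OF _ \<open>bdd_above U\<close>, of t] T(2) by force
    then show "K t / t \<le> g x / 4" using \<open>2 * T \<le> t\<close> \<open>0 < T\<close> by (simp add: U_def)
  qed
qed

text \<open>Each \<open>g x powr p\<close> is spread over the times \<open>t \<ge> 2 * T x\<close>.
  At a given \<open>t\<close> only vertices with \<open>g x \<ge> 4 * (K t / t)\<close> take part,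
  so \<open>sum_large_grad_le_K\<close> bounds their total by the integrand of the K-method.\<close>

lemma grad_power_sum_le_K_integral:
  assumes fin: "K_integral (W_dot \<mu> (ereal q)) (W_dot \<mu> \<infinity>) (1 - q / p) p F < \<infinity>"
    and A: "finite A"
  shows "(\<Sum>x\<in>A. g x powr p * vertex_weight \<mu> x)
     \<le> 4 powr q * 8 powr (p - q) * (p - q)
        * enn2real (K_integral (W_dot \<mu> (ereal q)) (W_dot \<mu> \<infinity>) (1 - q / p) p F)"
proof -
  let ?m = "vertex_weight \<mu>" and ?I = "K_integral (W_dot \<mu> (ereal q)) (W_dot \<mu> \<infinity>) (1 - q / p) p F"
  define \<delta> where "\<delta> = p - q"
  have \<delta>: "0 < \<delta>" using qp by (simp add: \<delta>_def)
  define A' where "A' = {x\<in>A. 0 < g x}"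
  have A': "finite A'" using A by (simp add: A'_def)
  have "\<forall>x\<in>A'. \<exists>T>0. g x / 4 < K T / T \<and> (\<forall>t\<ge>2 * T. K t / t \<le> g x / 4)"
    using K_crosses_level[OF fin] unfolding A'_def by (metis (no_types, lifting) mem_Collect_eq)
  then obtain T where T: "\<And>x. x \<in> A' \<Longrightarrow> 0 < T x" "\<And>x. x \<in> A' \<Longrightarrow> g x / 4 < K (T x) / T x"
      "\<And>x t. x \<in> A' \<Longrightarrow> 2 * T x \<le> t \<Longrightarrow> K t / t \<le> g x / 4"
    by metis
  \<comment> \<open>The integral of \<open>c x * t powr (- \<delta> - 1)\<close> over
    \<open>t \<ge> 2 * T x\<close> is a constant times \<open>g x powr p * ?m x\<close>, whereas
    \<open>T x * g x / 4 \<le> K t\<close> controls \<open>c x\<close> by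
    \<open>K t\<close>.\<close>
  define c where "c x = g x powr q * ?m x * (T x * g x / 4) powr \<delta> / 4 powr q" for x
  have c: "0 \<le> c x" for x by (simp add: c_def)
  have "(\<Sum>x\<in>A'. ennreal (c x * ((2 * T x) powr - \<delta> / \<delta>)))
      = (\<Sum>x\<in>A'. ennreal (c x) * (\<integral>\<^sup>+t\<in>{2 * T x..}. ennreal (t powr (- \<delta> - 1)) \<partial>lborel))"
    using \<delta> T(1) c by (intro sum.cong refl) (subst nn_integral_powr_inf, auto simp: ennreal_mult simp del: times_divide_eq_right)
  also have "\<dots> = (\<integral>\<^sup>+t. (\<Sum>x\<in>A'. ennreal (c x) * (ennreal (t powr (- \<delta> - 1)) * indicator {2 * T x..} t)) \<partial>lborel)"
    by (simp add: nn_integral_sum nn_integral_cmult)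
  also have "\<dots> \<le> ?I"
    unfolding K_integral_def
  proof (rule nn_integral_mono)
    fix t :: real
    define At where "At = {x\<in>A'. 2 * T x \<le> t}"
    have fin_At: "finite At" using A' by (simp add: At_def)
    have "(\<Sum>x\<in>A'. ennreal (c x) * (ennreal (t powr (- \<delta> - 1)) * indicator {2 * T x..} t))
        = (\<Sum>x\<in>A'. if 2 * T x \<le> t then ennreal (c x * t powr (- \<delta> - 1)) else 0)"
      using c by (intro sum.cong) (auto simp: ennreal_mult)
    also have "\<dots> = (\<Sum>x\<in>At. ennreal (c x * t powr (- \<delta> - 1)))"
      using A' by (simp add: At_def sum.inter_filter)
    also have "\<dots> = ennreal (\<Sum>x\<in>At. c x * t powr (- \<delta> - 1))"
      using c by (intro sum_ennreal) simp
    finally have eq: "(\<Sum>x\<in>A'. ennreal (c x) * (ennreal (t powr (- \<delta> - 1)) * indicator {2 * T x..} t))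
        = ennreal (\<Sum>x\<in>At. c x * t powr (- \<delta> - 1))" .
    show "(\<Sum>x\<in>A'. ennreal (c x) * (ennreal (t powr (- \<delta> - 1)) * indicator {2 * T x..} t))
        \<le> ennreal ((t powr (- (1 - q / p)) * K t) powr p / t) * indicator {0<..} t"
    proof (cases "At = {}")
      case False
      then obtain x0 where x0: "x0 \<in> A'" "2 * T x0 \<le> t" by (auto simp: At_def)
      have t: "0 < t" using T(1)[OF x0(1)] x0(2) by linarith
      have slope: "T x * g x / 4 \<le> K t" if "x \<in> At" for x
      proof -
        have x: "x \<in> A'" "2 * T x \<le> t" using that by (auto simp: At_def)
        have "g x / 4 * T x < K (T x)" using T(1,2)[OF x(1)] by (simp add: field_simps)
        moreover have "K (T x) \<le> K t"
          using T(1)[OF x(1)] x(2) by (intro W.K_functional_mono[OF decomp]) auto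
        ultimately show ?thesis by (simp add: mult.commute)
      qed
      have "0 < T x0 * g x0 / 4"
        using T(1)[OF x0(1)] x0(1) by (simp add: A'_def)
      then have Kt: "0 < K t" using slope[of x0] x0 by (simp add: At_def)
      have "(\<Sum>x\<in>At. c x * t powr (- \<delta> - 1))
          \<le> (\<Sum>x\<in>At. g x powr q * ?m x * (K t powr \<delta> * t powr (- \<delta> - 1) / 4 powr q))"
      proof (intro sum_mono)
        fix x assume x: "x \<in> At"
        then have "0 \<le> T x" using T(1) by (auto simp: At_def less_imp_le)
        then have "(T x * g x / 4) powr \<delta> \<le> K t powr \<delta>"
          using \<delta> slope[OF x] by (intro powr_mono2) auto
        then have "g x powr q * ?m x * ((T x * g x / 4) powr \<delta> * (t powr (- \<delta> - 1) / 4 powr q))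
            \<le> g x powr q * ?m x * (K t powr \<delta> * (t powr (- \<delta> - 1) / 4 powr q))"
          by (intro mult_left_mono mult_right_mono) auto
        then show "c x * t powr (- \<delta> - 1)
            \<le> g x powr q * ?m x * (K t powr \<delta> * t powr (- \<delta> - 1) / 4 powr q)"
          by (simp add: c_def)
      qed
      also have "\<dots> = (\<Sum>x\<in>At. g x powr q * ?m x) * (K t powr \<delta> * t powr (- \<delta> - 1) / 4 powr q)"
        by (rule sum_distrib_right[symmetric])
      also have "\<dots> \<le> (4 * K t) powr q * (K t powr \<delta> * t powr (- \<delta> - 1) / 4 powr q)"
      proof (intro mult_right_mono sum_large_grad_le_K t fin_At Kt)
        show "4 * (K t / t) \<le> g x" if "x \<in> At" for x
          using T(3)[of x t] that unfolding At_def mem_Collect_eq by linarith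
      qed simp
      also have "\<dots> = K t powr (q + \<delta>) * t powr (- \<delta> - 1)"
        using Kt by (simp add: powr_mult powr_add)
      also have "\<dots> = (t powr (- (1 - q / p)) * K t) powr p / t"
        using Kt t q qp by (subst K_integrand_eq) (auto simp: \<delta>_def algebra_simps)
      finally show ?thesis
        unfolding eq using t by (simp add: ennreal_leI)
    qed (simp add: eq)
  qed
  finally have "ennreal (\<Sum>x\<in>A'. c x * ((2 * T x) powr - \<delta> / \<delta>)) \<le> ?I"
    using c \<delta> by (subst sum_ennreal[symmetric]) auto
  also have "?I = ennreal (enn2real ?I)" using fin by simp
  finally have "(\<Sum>x\<in>A'. c x * ((2 * T x) powr - \<delta> / \<delta>)) \<le> enn2real ?I"
    by (simp add: ennreal_le_iff)
  \<comment> \<open>The powers of \<open>T x\<close> cancel: \<open>T x * g x / 4\<close> divided by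
    \<open>2 * T x\<close> is \<open>g x / 8\<close>.\<close>
  moreover have "c x * ((2 * T x) powr - \<delta> / \<delta>) = g x powr p * ?m x / (4 powr q * 8 powr \<delta> * \<delta>)"
    if x: "x \<in> A'" for x
  proof -
    have Tx: "0 < T x" "0 < g x" using x T(1) by (auto simp: A'_def)
    have "(T x * g x / 4) powr \<delta> * (2 * T x) powr - \<delta> = (T x * g x / 4) powr \<delta> / (2 * T x) powr \<delta>"
      by (simp only: powr_minus divide_inverse)
    also have "\<dots> = ((T x * g x / 4) / (2 * T x)) powr \<delta>"
      using Tx by (subst powr_divide) auto
    also have "(T x * g x / 4) / (2 * T x) = g x / 8"
      using Tx by simp
    also have "(g x / 8) powr \<delta> = g x powr \<delta> / 8 powr \<delta>"
      by (simp add: powr_divide)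
    finally have *: "(T x * g x / 4) powr \<delta> * (2 * T x) powr - \<delta> = g x powr \<delta> / 8 powr \<delta>" .
    have "c x * ((2 * T x) powr - \<delta> / \<delta>)
        = g x powr q * ?m x * ((T x * g x / 4) powr \<delta> * (2 * T x) powr - \<delta>) / (4 powr q * \<delta>)"
      by (simp add: c_def)
    also have "\<dots> = (g x powr q * g x powr \<delta>) * ?m x / (4 powr q * 8 powr \<delta> * \<delta>)"
      unfolding * by (simp add: mult_ac)
    also have "g x powr q * g x powr \<delta> = g x powr p"
      by (simp add: \<delta>_def flip: powr_add)
    finally show ?thesis .
  qed
  ultimately have "(\<Sum>x\<in>A'. g x powr p * ?m x) / (4 powr q * 8 powr \<delta> * \<delta>) \<le> enn2real ?I"
    by (simp add: sum_divide_distrib)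
  \<comment> \<open>Vertices with zero gradient contribute \<open>0 powr p = 0\<close>.\<close>
  moreover have "(\<Sum>x\<in>A. g x powr p * ?m x) = (\<Sum>x\<in>A'. g x powr p * ?m x)"
    using A by (intro sum.mono_neutral_right) (auto simp: A'_def not_less order_antisym)
  ultimately show ?thesis
    using \<delta> by (simp add: \<delta>_def field_simps)
qed

end

end

section \<open>From Sobolev spaces to interpolation spaces\<close>

context weighted_graph begin

lemma nn_integral_count_space_le:
  assumes "\<And>x. 0 \<le> u x" "\<And>A. finite A \<Longrightarrow> (\<Sum>x\<in>A. u x) \<le> c"
  shows "(\<integral>\<^sup>+x. ennreal (u x) \<partial>count_space (UNIV :: 'a set)) \<le> ennreal c"
proof -
  let ?e = "from_nat_into (UNIV :: 'a set)"
  have bij: "bij_betw ?e UNIV UNIV"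
    using bij_betw_from_nat_into[OF countable_vertices infinite_vertices] .
  have "(\<integral>\<^sup>+x. ennreal (u x) \<partial>count_space (UNIV :: 'a set))
      = (\<integral>\<^sup>+n. ennreal (u (?e n)) \<partial>count_space UNIV)"
    by (rule nn_integral_bij_count_space[OF bij, symmetric])
  also have "\<dots> = (\<Sum>n. ennreal (u (?e n)))"
    by (rule nn_integral_count_space_nat)
  also have "\<dots> \<le> ennreal c"
  proof (rule suminf_le_const)
    fix n
    have "(\<Sum>i<n. u (?e i)) = (\<Sum>x\<in>?e ` {..<n}. u x)"
      using bij by (subst sum.reindex) (auto simp: bij_betw_def intro: inj_on_subset)
    also have "\<dots> \<le> c" by (intro assms) simp
    finally show "(\<Sum>i<n. ennreal (u (?e i))) \<le> ennreal c"
      using assms(1) by (simp add: sum_ennreal ennreal_leI)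
  qed simp
  finally show ?thesis .
qed

lemma sum_le_nn_integral_count_space:
  assumes "\<And>x. 0 \<le> u x" "finite A"
  shows "ennreal (\<Sum>x\<in>A. u x) \<le> (\<integral>\<^sup>+x. ennreal (u x) \<partial>count_space UNIV)"
proof -
  have "ennreal (\<Sum>x\<in>A. u x) = (\<integral>\<^sup>+x. ennreal (u x) \<partial>count_space A)"
    using assms by (simp add: nn_integral_count_space_finite sum_ennreal)
  also have "\<dots> = (\<integral>\<^sup>+x. ennreal (u x) * indicator A x \<partial>count_space UNIV)"
    by (subst nn_integral_count_space_indicator) auto
  also have "\<dots> \<le> (\<integral>\<^sup>+x. ennreal (u x) \<partial>count_space UNIV)"
    by (intro nn_integral_mono) (auto simp: indicator_def)
  finally show ?thesis .
qed

end

section \<open>The K-functional through the distribution of the gradient\<close>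

context doubling_graph begin

context
  fixes q P :: real and f :: "'a \<Rightarrow> 'k::{real_normed_field,banach}"
  assumes q: "1 \<le> q" and P: "0 < P"
    and poin: "\<And>x r. 0 < r \<Longrightarrow>
       (\<Sum>y\<in>graph_ball \<mu> x r. norm (f y - average \<mu> (graph_ball \<mu> x r) f) powr q * vertex_weight \<mu> y)
         \<le> P * r powr q * (\<Sum>y\<in>graph_ball \<mu> x r. grad \<mu> f y powr q * vertex_weight \<mu> y)"
begin

lemma calderon_zygmund_W_dot:
  assumes s: "0 < s"
    and H: "\<And>A. finite A \<Longrightarrow>
       (\<Sum>y\<in>{y\<in>A. s / 2 < grad \<mu> f y}. grad \<mu> f y powr q * vertex_weight \<mu> y) \<le> H"
  obtains a\<^sub>0 a\<^sub>1 :: "('a, 'k) fun_mod_const"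
  where "a\<^sub>0 \<in> elems (W_dot \<mu> (ereal q))" "a\<^sub>1 \<in> elems (W_dot \<mu> \<infinity>)" "mod_const f = a\<^sub>0 + a\<^sub>1"
    "norm_on (W_dot \<mu> (ereal q)) a\<^sub>0 \<le> (cz_const P q * H) powr (1 / q)"
    "norm_on (W_dot \<mu> \<infinity>) a\<^sub>1 \<le> cz_slope P q * s"
proof -
  obtain b where b: "\<And>A. finite A \<Longrightarrow> (\<Sum>x\<in>A. grad \<mu> b x powr q * vertex_weight \<mu> x) \<le> cz_const P q * H"
    "\<And>x. grad \<mu> (\<lambda>x. f x - b x) x \<le> cz_slope P q * s"
    using calderon_zygmund[OF q P s poin H] by blast
  have "mod_const f = mod_const b + mod_const (\<lambda>x. f x - b x)"
    by (simp add: plus_fun_mod_const.abs_eq)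
  moreover have "grad \<mu> b \<in> Lp_space \<mu> (ereal q)"
      "Lp_norm \<mu> (ereal q) (grad \<mu> b) \<le> (cz_const P q * H) powr (1 / q)"
    using q b(1) Lp_space_bounded_sums[of q "grad \<mu> b" "cz_const P q * H"] by simp_all
  moreover have "grad \<mu> (\<lambda>x. f x - b x) \<in> Lp_space \<mu> \<infinity>"
      "Lp_norm \<mu> \<infinity> (grad \<mu> (\<lambda>x. f x - b x)) \<le> cz_slope P q * s"
    using b(2) Linf_space_bounded[of "grad \<mu> (\<lambda>x. f x - b x)" "cz_slope P q * s"] by simp_all
  ultimately show ?thesis
    by (intro that[of "mod_const b" "mod_const (\<lambda>x. f x - b x)"]) (simp_all add: mem_W_dot norm_on_W_dot)
qed

text \<open>The hypothesis on the mass above \<open>s / 2\<close> balances the decomposition at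
  level \<open>s\<close>: both of its terms are then of order \<open>t * s\<close>.\<close>

lemma K_functional_lt:
  assumes s: "0 < s" and t: "0 < t"
    and H: "\<And>A. finite A \<Longrightarrow>
       (\<Sum>y\<in>{y\<in>A. s / 2 < grad \<mu> f y}. grad \<mu> f y powr q * vertex_weight \<mu> y) \<le> s powr q * t powr q"
  shows "K_functional (W_dot \<mu> (ereal q)) (W_dot \<mu> \<infinity>) t (mod_const f) < interp_const P q * t * s"
proof -
  interpret W: normed_couple
    "W_dot \<mu> (ereal q) :: ('a, 'k) fun_mod_const normed_subspace" "W_dot \<mu> \<infinity>"
    by (rule normed_couple_W_dot)
  obtain a\<^sub>0 a\<^sub>1 :: "('a, 'k) fun_mod_const"
    where a: "a\<^sub>0 \<in> elems (W_dot \<mu> (ereal q))" "a\<^sub>1 \<in> elems (W_dot \<mu> \<infinity>)" "mod_const f = a\<^sub>0 + a\<^sub>1"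
    "norm_on (W_dot \<mu> (ereal q)) a\<^sub>0 \<le> (cz_const P q * (s powr q * t powr q)) powr (1 / q)"
    "norm_on (W_dot \<mu> \<infinity>) a\<^sub>1 \<le> cz_slope P q * s"
    using calderon_zygmund_W_dot[OF s H] by blast
  have "(cz_const P q * (s powr q * t powr q)) powr (1 / q) = cz_const P q powr (1 / q) * (s * t)"
    using q s t cz_const_nonneg by (simp add: powr_mult powr_powr)
  then have "norm_on (W_dot \<mu> (ereal q)) a\<^sub>0 + t * norm_on (W_dot \<mu> \<infinity>) a\<^sub>1
      \<le> cz_const P q powr (1 / q) * (s * t) + t * (cz_slope P q * s)"
    using a t by (intro add_mono mult_left_mono) auto
  also have "\<dots> < interp_const P q * t * s"
    using s t by (simp add: interp_const_def algebra_simps)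
  finally show ?thesis
    using W.K_functional_le[OF a(1-3), of t] t by linarith
qed

context
  fixes p :: real
  assumes qp: "q < p" and Lp: "grad \<mu> f \<in> Lp_space \<mu> (ereal p)"
begin

private abbreviation grad_f :: "'a \<Rightarrow> real" where
  "grad_f \<equiv> grad \<mu> f"

text \<open>The decomposition at level 1 suffices: where the gradient exceeds 1/2, its
  \<open>q\<close>-th power is at most \<open>2 powr (p - q)\<close> times its \<open>p\<close>-th
  power.\<close>

lemma mod_const_in_sum:
  "\<exists>a\<^sub>0\<in>elems (W_dot \<mu> (ereal q)). \<exists>a\<^sub>1\<in>elems (W_dot \<mu> \<infinity>). mod_const f = a\<^sub>0 + a\<^sub>1"
proof -
  have "(\<Sum>y\<in>{y\<in>A. 1 / 2 < grad_f y}. grad_f y powr q * vertex_weight \<mu> y) \<le> 2 powr (p - q) * Lp_norm \<mu> (ereal p) grad_f powr p"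
    if A: "finite A" for A
  proof -
    have "(\<Sum>y\<in>{y\<in>A. 1 / 2 < grad_f y}. grad_f y powr q * vertex_weight \<mu> y)
        \<le> (\<Sum>y\<in>{y\<in>A. 1 / 2 < grad_f y}. 2 powr (p - q) * (grad_f y powr p * vertex_weight \<mu> y))"
    proof (intro sum_mono)
      fix y assume y: "y \<in> {y\<in>A. 1 / 2 < grad_f y}"
      have "grad_f y powr q * 1 \<le> grad_f y powr q * (2 * grad_f y) powr (p - q)"
        using y qp by (intro mult_left_mono ge_one_powr_ge_zero) auto
      also have "\<dots> = 2 powr (p - q) * grad_f y powr p"
        by (simp add: powr_mult flip: powr_add)
      finally show "grad_f y powr q * vertex_weight \<mu> y \<le> 2 powr (p - q) * (grad_f y powr p * vertex_weight \<mu> y)"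
        by (simp add: mult_right_mono flip: mult.assoc)
    qed
    also have "\<dots> = 2 powr (p - q) * (\<Sum>y\<in>{y\<in>A. 1 / 2 < grad_f y}. \<bar>grad_f y\<bar> powr p * vertex_weight \<mu> y)"
      by (simp add: sum_distrib_left)
    also have "\<dots> \<le> 2 powr (p - q) * Lp_norm \<mu> (ereal p) grad_f powr p"
      using A q qp Lp by (intro mult_left_mono sum_le_Lp_norm) auto
    finally show ?thesis .
  qed
  from calderon_zygmund_W_dot[of 1, OF _ this] show ?thesis by (metis zero_less_one)
qed

text \<open>An extended integral, so that measurability in \<open>s\<close> and Tonelli are
  available without first proving finiteness.\<close>

definition level_mass :: "real \<Rightarrow> ennreal" where
  "level_mass s = (\<integral>\<^sup>+x. ennreal (if s < 2 * grad_f x then grad_f x powr q * vertex_weight \<mu> x else 0) \<partial>count_space UNIV)"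

lemma sum_le_level_mass:
  assumes "finite A" "level_mass s \<le> ennreal c" "0 \<le> c"
  shows "(\<Sum>y\<in>{y\<in>A. s / 2 < grad_f y}. grad_f y powr q * vertex_weight \<mu> y) \<le> c"
proof -
  have "(\<Sum>y\<in>{y\<in>A. s / 2 < grad_f y}. grad_f y powr q * vertex_weight \<mu> y)
      = (\<Sum>y\<in>A. if s < 2 * grad_f y then grad_f y powr q * vertex_weight \<mu> y else 0)"
    using assms(1) by (subst sum.inter_filter) (auto intro!: sum.cong)
  also have "ennreal \<dots> \<le> level_mass s"
    unfolding level_mass_def using assms(1) by (intro sum_le_nn_integral_count_space) auto
  finally show ?thesis
    using assms(2,3) by (metis (no_types, lifting) ennreal_le_iff order_trans)
qed

lemma measurable_level_mass [measurable]: "level_mass \<in> borel_measurable borel"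
proof -
  interpret sigma_finite_measure "count_space (UNIV :: 'a set)"
    by (rule sigma_finite_measure_count_space_countable[OF countable_vertices])
  have [measurable]: "grad_f \<in> borel_measurable (count_space UNIV)" "vertex_weight \<mu> \<in> borel_measurable (count_space UNIV)"
    by simp_all
  show ?thesis
    unfolding level_mass_def[abs_def] by measurable
qed

text \<open>Supported where the hypothesis of \<open>K_functional_lt\<close> fails. Integrating in
  \<open>s\<close> dominates the integrand of the K-method; integrating in \<open>t\<close> returns
  the level mass.\<close>

definition level_kernel :: "real \<Rightarrow> real \<Rightarrow> ennreal" where
  "level_kernel t s = (if 0 < s \<and> 0 < t \<and> ennreal (s powr q * t powr q) < level_mass s
     then ennreal (t powr (q - 1) * s powr (p - 1)) else 0)"

lemma measurable_level_kernel [measurable]: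
  "case_prod level_kernel \<in> borel_measurable (borel \<Otimes>\<^sub>M borel)"
  unfolding level_kernel_def[abs_def] by measurable

text \<open>Every \<open>s\<close> in \<open>{0<..k}\<close> lies in the support of the kernel:
  otherwise \<open>K_functional_lt\<close> would give \<open>?K < ?M * t * s\<close>, which is at
  most \<open>?M * t * k = ?K\<close>. Integrating \<open>s powr (p - 1)\<close> up to
  \<open>k\<close> gives the claim.\<close>

lemma K_integrand_le:
  assumes t: "0 < t"
  shows "ennreal ((t powr - (1 - q / p) * K_functional (W_dot \<mu> (ereal q)) (W_dot \<mu> \<infinity>) t (mod_const f)) powr p / t)
     \<le> ennreal (p * interp_const P q powr p) * (\<integral>\<^sup>+s. level_kernel t s \<partial>lborel)"
proof -
  interpret W: normed_couple
    "W_dot \<mu> (ereal q) :: ('a, 'k) fun_mod_const normed_subspace" "W_dot \<mu> \<infinity>"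
    by (rule normed_couple_W_dot)
  let ?M = "interp_const P q"
  let ?K = "K_functional (W_dot \<mu> (ereal q)) (W_dot \<mu> \<infinity>) t (mod_const f)"
  define k where "k = ?K / (?M * t)"
  have p: "0 < p" using q qp by simp
  have K: "0 \<le> ?K"
    using t by (intro W.K_functional_nonneg[OF mod_const_in_sum]) simp
  then have k: "0 \<le> k" using interp_const_pos[of P q] t by (simp add: k_def)
  have le: "ennreal (t powr (q - 1) * s powr (p - 1)) \<le> level_kernel t s" if s: "0 < s" "s \<le> k" for s
  proof -
    have "\<not> level_mass s \<le> ennreal (s powr q * t powr q)"
    proof
      assume "level_mass s \<le> ennreal (s powr q * t powr q)"
      then have "?K < ?M * t * s"
        using s(1) t by (intro K_functional_lt sum_le_level_mass) auto
      moreover have "?M * t * s \<le> ?K"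
        using s(2) interp_const_pos[of P q] t by (simp add: k_def field_simps)
      ultimately show False by simp
    qed
    then show ?thesis using s t by (simp add: level_kernel_def)
  qed
  have "ennreal (t powr (q - 1) * (k powr p / p))
      = ennreal (t powr (q - 1)) * (\<integral>\<^sup>+s\<in>{0<..k}. ennreal (s powr (p - 1)) \<partial>lborel)"
    using p k by (subst nn_integral_powr_0) (auto simp: ennreal_mult simp del: times_divide_eq_right)
  also have "\<dots> = (\<integral>\<^sup>+s\<in>{0<..k}. ennreal (t powr (q - 1) * s powr (p - 1)) \<partial>lborel)"
    by (subst nn_integral_cmult[symmetric]) (auto simp: ennreal_mult mult.assoc)
  also have "\<dots> \<le> (\<integral>\<^sup>+s. level_kernel t s \<partial>lborel)"
    using le by (intro nn_integral_mono) (auto simp: indicator_def)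
  finally have "ennreal (p * ?M powr p) * ennreal (t powr (q - 1) * (k powr p / p))
      \<le> ennreal (p * ?M powr p) * (\<integral>\<^sup>+s. level_kernel t s \<partial>lborel)"
    by (rule mult_left_mono) simp
  moreover have "(t powr - (1 - q / p) * ?K) powr p / t = p * ?M powr p * (t powr (q - 1) * (k powr p / p))"
  proof -
    have "(t powr - (1 - q / p) * ?K) powr p / t = ?K powr p * t powr (q - p - 1)"
      using t K p by (rule K_integrand_eq)
    also have "?K powr p = ?M powr p * t powr p * k powr p"
    proof -
      have "?K = ?M * t * k" using interp_const_pos[of P q] t by (simp add: k_def)
      then have "?K powr p = (?M * t * k) powr p" by (rule arg_cong)
      then show ?thesis by (simp only: powr_mult)
    qed
    also have "?M powr p * t powr p * k powr p * t powr (q - p - 1)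
        = ?M powr p * k powr p * (t powr p * t powr (q - p - 1))"
      by simp
    also have "t powr p * t powr (q - p - 1) = t powr (q - 1)"
      by (simp flip: powr_add)
    finally show ?thesis using p by simp
  qed
  ultimately show ?thesis
    using p by (simp add: ennreal_mult'[symmetric])
qed

text \<open>For finite mass \<open>h\<close> the support in \<open>t\<close> ends at
  \<open>c\<close>, where \<open>s powr q * c powr q = h\<close>; for infinite mass and positive
  \<open>s\<close> the right-hand side is infinite.\<close>

lemma level_kernel_integral_le:
  "(\<integral>\<^sup>+t. level_kernel t s \<partial>lborel)
     \<le> (if 0 < s then ennreal (s powr (p - q - 1) / q) * level_mass s else 0)"
proof (cases "0 < s")
  case s: True
  show ?thesis
  proof (cases "level_mass s")
    case (real h)
    define c where "c = (h / s powr q) powr (1 / q)"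
    have "(\<integral>\<^sup>+t. level_kernel t s \<partial>lborel)
        \<le> (\<integral>\<^sup>+t. ennreal (s powr (p - 1)) * (ennreal (t powr (q - 1)) * indicator {0<..c} t) \<partial>lborel)"
    proof (intro nn_integral_mono)
      fix t
      have "t \<le> c" if "0 < t" "s powr q * t powr q < h"
      proof -
        have "t = (t powr q) powr (1 / q)" using that q by (simp add: powr_powr)
        also have "\<dots> \<le> c"
          unfolding c_def using that q s by (intro powr_mono2) (auto simp: field_simps)
        finally show ?thesis .
      qed
      then show "level_kernel t s
          \<le> ennreal (s powr (p - 1)) * (ennreal (t powr (q - 1)) * indicator {0<..c} t)"
        using real by (auto simp: level_kernel_def indicator_def ennreal_less_iff mult.commute
            simp flip: ennreal_mult)
    qed
    also have "\<dots> = ennreal (s powr (p - 1)) * ennreal (c powr q / q)"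
      using q by (subst nn_integral_cmult) (auto simp: nn_integral_powr_0 c_def)
    also have "c powr q = h / s powr q"
      using q real s by (simp add: c_def powr_powr)
    also have "ennreal (s powr (p - 1)) * ennreal (h / s powr q / q)
        = ennreal (s powr (p - q - 1) / q) * level_mass s"
      using q real s by (simp add: powr_diff mult_ac flip: ennreal_mult)
    finally show ?thesis using s by simp
  next
    case top
    have "0 < s powr (p - q - 1) / q" using s q by simp
    then show ?thesis using q s top by (simp add: ennreal_mult_top)
  qed
qed (simp add: level_kernel_def)

text \<open>After Tonelli the vertex \<open>x\<close> contributes the integral of
  \<open>s powr (p - q - 1)\<close> over \<open>{0<..2 * grad_f x}\<close>, which supplies the
  missing power \<open>p - q\<close> of the gradient.\<close>

lemma level_mass_integral_le:
  "(\<integral>\<^sup>+s. (if 0 < s then ennreal (s powr (p - q - 1) / q) * level_mass s else 0) \<partial>lborel)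
     \<le> ennreal (2 powr (p - q) / (q * (p - q)) * Lp_norm \<mu> (ereal p) grad_f powr p)"
proof -
  define C where "C = 2 powr (p - q) / (q * (p - q))"
  have C: "0 \<le> C" using q qp by (simp add: C_def)
  have "(\<integral>\<^sup>+s. (if 0 < s then ennreal (s powr (p - q - 1) / q) * level_mass s else 0) \<partial>lborel)
      \<le> (\<integral>\<^sup>+s. \<integral>\<^sup>+x. ennreal (grad_f x powr q * vertex_weight \<mu> x / q) * (ennreal (s powr (p - q - 1)) * indicator {0<..2 * grad_f x} s)
          \<partial>count_space UNIV \<partial>lborel)"
  proof (intro nn_integral_mono)
    fix s :: real
    have "ennreal (s powr (p - q - 1) / q) * level_mass s
        = (\<integral>\<^sup>+x. ennreal (s powr (p - q - 1) / q) * ennreal (if s < 2 * grad_f x then grad_f x powr q * vertex_weight \<mu> x else 0)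
            \<partial>count_space UNIV)"
      unfolding level_mass_def by (rule nn_integral_cmult[symmetric]) simp
    also have "\<dots> \<le> (\<integral>\<^sup>+x. ennreal (grad_f x powr q * vertex_weight \<mu> x / q) * (ennreal (s powr (p - q - 1)) * indicator {0<..2 * grad_f x} s)
            \<partial>count_space UNIV)" if "0 < s"
      using that q by (intro nn_integral_mono)
        (auto simp: indicator_def mult.commute simp flip: ennreal_mult)
    finally show "(if 0 < s then ennreal (s powr (p - q - 1) / q) * level_mass s else 0)
        \<le> (\<integral>\<^sup>+x. ennreal (grad_f x powr q * vertex_weight \<mu> x / q) * (ennreal (s powr (p - q - 1)) * indicator {0<..2 * grad_f x} s)
            \<partial>count_space UNIV)" by simp
  qed
  also have "\<dots> = (\<integral>\<^sup>+x. \<integral>\<^sup>+s. ennreal (grad_f x powr q * vertex_weight \<mu> x / q) * (ennreal (s powr (p - q - 1)) * indicator {0<..2 * grad_f x} s)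
          \<partial>lborel \<partial>count_space UNIV)"
    by (rule nn_integral_count_space_nn_integral[OF countable_vertices]) measurable
  also have "\<dots> = (\<integral>\<^sup>+x. ennreal (C * (grad_f x powr p * vertex_weight \<mu> x)) \<partial>count_space UNIV)"
  proof (intro nn_integral_cong)
    fix x
    have "(\<integral>\<^sup>+s. ennreal (grad_f x powr q * vertex_weight \<mu> x / q) * (ennreal (s powr (p - q - 1)) * indicator {0<..2 * grad_f x} s) \<partial>lborel)
        = ennreal (grad_f x powr q * vertex_weight \<mu> x / q) * ennreal ((2 * grad_f x) powr (p - q) / (p - q))"
      using qp by (subst nn_integral_cmult) (auto simp: nn_integral_powr_0)
    also have "\<dots> = ennreal (grad_f x powr q * vertex_weight \<mu> x / q * ((2 * grad_f x) powr (p - q) / (p - q)))"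
      using q qp by (subst ennreal_mult) auto
    also have "grad_f x powr q * vertex_weight \<mu> x / q * ((2 * grad_f x) powr (p - q) / (p - q))
        = C * ((grad_f x powr q * grad_f x powr (p - q)) * vertex_weight \<mu> x)"
      by (simp add: C_def powr_mult)
    also have "grad_f x powr q * grad_f x powr (p - q) = grad_f x powr p"
      by (simp flip: powr_add)
    finally show "(\<integral>\<^sup>+s. ennreal (grad_f x powr q * vertex_weight \<mu> x / q) * (ennreal (s powr (p - q - 1)) * indicator {0<..2 * grad_f x} s) \<partial>lborel)
        = ennreal (C * (grad_f x powr p * vertex_weight \<mu> x))" .
  qed
  also have "\<dots> \<le> ennreal (C * Lp_norm \<mu> (ereal p) grad_f powr p)"
  proof (rule nn_integral_count_space_le)
    fix A :: "'a set" assume "finite A"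
    then have "(\<Sum>x\<in>A. \<bar>grad_f x\<bar> powr p * vertex_weight \<mu> x) \<le> Lp_norm \<mu> (ereal p) grad_f powr p"
      using q qp Lp by (intro sum_le_Lp_norm) auto
    then show "(\<Sum>x\<in>A. C * (grad_f x powr p * vertex_weight \<mu> x)) \<le> C * Lp_norm \<mu> (ereal p) grad_f powr p"
      using C by (simp add: mult_left_mono flip: sum_distrib_left)
  qed (use C in simp)
  finally show ?thesis by (simp add: C_def)
qed

lemma K_integral_le:
  "K_integral (W_dot \<mu> (ereal q)) (W_dot \<mu> \<infinity>) (1 - q / p) p (mod_const f)
     \<le> ennreal (p * interp_const P q powr p * (2 powr (p - q) / (q * (p - q)))
          * Lp_norm \<mu> (ereal p) (grad \<mu> f) powr p)"
proof -
  have "K_integral (W_dot \<mu> (ereal q)) (W_dot \<mu> \<infinity>) (1 - q / p) p (mod_const f)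
      \<le> (\<integral>\<^sup>+t. ennreal (p * interp_const P q powr p) * (\<integral>\<^sup>+s. level_kernel t s \<partial>lborel) \<partial>lborel)"
    unfolding K_integral_def using K_integrand_le by (intro nn_integral_mono) (auto simp: indicator_def)
  also have "\<dots> = ennreal (p * interp_const P q powr p) * (\<integral>\<^sup>+t. \<integral>\<^sup>+s. level_kernel t s \<partial>lborel \<partial>lborel)"
    by (rule nn_integral_cmult) measurable
  also have "(\<integral>\<^sup>+t. \<integral>\<^sup>+s. level_kernel t s \<partial>lborel \<partial>lborel) = (\<integral>\<^sup>+s. \<integral>\<^sup>+t. level_kernel t s \<partial>lborel \<partial>lborel)"
    by (rule lborel_pair.Fubini'[symmetric]) measurable
  also have "\<dots> \<le> (\<integral>\<^sup>+s. (if 0 < s then ennreal (s powr (p - q - 1) / q) * level_mass s else 0) \<partial>lborel)"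
    by (intro nn_integral_mono level_kernel_integral_le)
  also have "\<dots> \<le> ennreal (2 powr (p - q) / (q * (p - q)) * Lp_norm \<mu> (ereal p) grad_f powr p)"
    by (rule level_mass_integral_le)
  finally show ?thesis
    using q qp by (simp add: mult.assoc mult_left_mono ennreal_mult' flip: times_divide_eq_right)
qed

end

end

end

section \<open>Both inclusions combined, with explicit norm constants\<close>

theorem theorem1p17:
  fixes \<mu> :: "'a \<Rightarrow> 'a \<Rightarrow> real" and q p \<alpha> :: real
  assumes "weighted_graph \<mu>"
    and "q \<ge> 1"
    and "doubling \<mu>"
    and "poincare TYPE('k::{real_normed_field,banach}) \<mu> q"
    and "\<alpha> > 0" and "delta_condition \<mu> \<alpha>"
    and "q < p"
  shows "same_space_equiv_norms
           (W_dot \<mu> (ereal p) :: ('a, 'k) fun_mod_const normed_subspace)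
           (real_interpolation (W_dot \<mu> (ereal q)) (W_dot \<mu> \<infinity>) (1 - q / p) p)"
proof -
  interpret weighted_graph \<mu> by fact
  obtain C where C: "0 < C" "\<And>x r. 0 < r \<Longrightarrow>
      volume \<mu> (graph_ball \<mu> x (2 * r)) \<le> C * volume \<mu> (graph_ball \<mu> x r)"
    using assms(3) unfolding doubling_def by blast
  \<comment> \<open>The maximum with 1 provides the normalisation \<open>D_ge_1\<close>.\<close>
  interpret doubling_graph \<mu> "max 1 C"
  proof
    fix r x assume "(0::real) < r"
    then have "volume \<mu> (graph_ball \<mu> x (2 * r)) \<le> C * volume \<mu> (graph_ball \<mu> x r)" by (rule C(2))
    also have "\<dots> \<le> max 1 C * volume \<mu> (graph_ball \<mu> x r)"
      by (intro mult_right_mono) auto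
    finally show "volume \<mu> (graph_ball \<mu> x (2 * r)) \<le> max 1 C * volume \<mu> (graph_ball \<mu> x r)" .
  qed simp
  obtain P where P: "0 < P" and poin: "\<And>(f :: 'a \<Rightarrow> 'k) x r. 0 < r \<Longrightarrow>
      (\<Sum>y\<in>graph_ball \<mu> x r. norm (f y - average \<mu> (graph_ball \<mu> x r) f) powr q * vertex_weight \<mu> y)
        \<le> P * r powr q * (\<Sum>y\<in>graph_ball \<mu> x r. grad \<mu> f y powr q * vertex_weight \<mu> y)"
    using assms(4) unfolding poincare_def Let_def by blast
  have p: "0 < p" using assms by linarith
  let ?I = "\<lambda>F :: ('a, 'k) fun_mod_const.
    K_integral (W_dot \<mu> (ereal q)) (W_dot \<mu> \<infinity>) (1 - q / p) p F"
  let ?N = "\<lambda>F :: ('a, 'k) fun_mod_const. Lp_norm \<mu> (ereal p) (grad_mod_const \<mu> F)"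
  let ?sum = "\<lambda>F :: ('a, 'k) fun_mod_const.
    \<exists>a\<^sub>0\<in>elems (W_dot \<mu> (ereal q)). \<exists>a\<^sub>1\<in>elems (W_dot \<mu> \<infinity>). F = a\<^sub>0 + a\<^sub>1"
  have N: "0 \<le> ?N F" for F by (simp add: Lp_norm_def)
  define C1 where "C1 = p * interp_const P q powr p * (2 powr (p - q) / (q * (p - q)))"
  define C2 where "C2 = 4 powr q * 8 powr (p - q) * (p - q)"
  have C1: "0 < C1"
    using interp_const_pos[of P q] assms(2,7) by (simp add: C1_def)
  have C2: "0 < C2" using assms(7) by (simp add: C2_def)
  have upper: "?sum F" "?I F \<le> ennreal (C1 * ?N F powr p)" if F: "F \<in> elems (W_dot \<mu> (ereal p))" for F
  proof -
    obtain f where f: "F = mod_const f" by (rule mod_const_exhaust)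
    have Lp: "grad \<mu> f \<in> Lp_space \<mu> (ereal p)" using F by (simp add: mem_W_dot f)
    show "?sum F" unfolding f by (rule mod_const_in_sum[OF assms(2) P poin assms(7) Lp])
    show "?I F \<le> ennreal (C1 * ?N F powr p)"
      using K_integral_le[OF assms(2) P poin assms(7) Lp] by (simp add: f C1_def)
  qed
  have lower: "F \<in> elems (W_dot \<mu> (ereal p))" "?N F \<le> (C2 * enn2real (?I F)) powr (1 / p)"
    if "?sum F" "?I F < \<infinity>" for F
    using Lp_space_bounded_sums[of p "grad_mod_const \<mu> F" "C2 * enn2real (?I F)"]
      grad_power_sum_le_K_integral[OF assms(2,7) that] p
    by (simp_all add: mem_W_dot C2_def)
  let ?W = "W_dot \<mu> (ereal p) :: ('a, 'k) fun_mod_const normed_subspace"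
  let ?R = "real_interpolation (W_dot \<mu> (ereal q)) (W_dot \<mu> \<infinity>) (1 - q / p) p
    :: ('a, 'k) fun_mod_const normed_subspace"
  have elems_eq: "elems ?W = elems ?R"
  proof (intro set_eqI iffI)
    fix F assume "F \<in> elems ?W"
    from upper[OF this]
    show "F \<in> elems ?R"
      by (auto simp: real_interpolation_def intro: le_less_trans)
  next
    fix F assume "F \<in> elems ?R"
    then have "?sum F" "?I F < \<infinity>" by (simp_all add: real_interpolation_def)
    then show "F \<in> elems (W_dot \<mu> (ereal p))" by (rule lower(1))
  qed
  have norms: "1 / C2 powr (1 / p) * norm_on ?W F \<le> norm_on ?R F \<and> norm_on ?R F \<le> C1 powr (1 / p) * norm_on ?W F"
    if F: "F \<in> elems ?W" for F
  proof -
    have fin: "?I F < \<infinity>"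
      using upper(2)[OF F] by (rule le_less_trans) simp
    have "?N F \<le> C2 powr (1 / p) * enn2real (?I F) powr (1 / p)"
      using lower(2)[OF upper(1)[OF F] fin] by (simp add: powr_mult)
    then have lo: "1 / C2 powr (1 / p) * norm_on ?W F \<le> norm_on ?R F"
      using C2 by (simp add: norm_on_W_dot real_interpolation_def field_simps)
    have "enn2real (?I F) \<le> C1 * ?N F powr p"
      using upper(2)[OF F] C1 by (intro enn2real_leI) auto
    then have "enn2real (?I F) powr (1 / p) \<le> (C1 * ?N F powr p) powr (1 / p)"
      using p by (intro powr_mono2) auto
    also have "\<dots> = C1 powr (1 / p) * ?N F"
      using p N[of F] by (simp add: powr_mult powr_powr)
    finally have up: "norm_on ?R F \<le> C1 powr (1 / p) * norm_on ?W F"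
      by (simp add: norm_on_W_dot real_interpolation_def)
    show ?thesis using lo up by (rule conjI)
  qed
  have "0 < 1 / C2 powr (1 / p)" "0 < C1 powr (1 / p)"
    using C1 C2 by simp_all
  with elems_eq norms show ?thesis
    unfolding same_space_equiv_norms_def by blast
qed

end
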